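(* Let $L$ be a number field, let $A\le B$ be integers, write $D=B-A$ and $M=\max\{|A|,|B|\}$. Let $F\in L[X]$ be a polynomial of degree at most $d\geq 1$, let $N\geq d+1$, let $H$ be a real number, and let $x_1,\ldots,x_N$ be distinct elements of $\{x\in\mathbb{Z}:A\le x\le B\}$. Assume that $h(F(x_i))\leq H$ for every $1\le i\le N$. Then \[ h(F)\leq \frac{N}{N-d}H + D\log(D) + d\log(2M)+\log(d+1). \] More precisely, for every place $v$ of $L$, \[ \log\max\{1,|F|_v\}\leq C_v + \frac{1}{N-d}\sum_{i=1}^N\log\max\{1,|F(x_i)|_v\}, \] where $C_v=\log|1/D!|_v$ if $v$ is nonarchimedean and $C_v=d\log(2M)+\log(d+1)$ if $v$ is archimedean.
   Context: For a number field $L$ of degree $d_L$ over $\mathbb{Q}$ and a place $v$ of $L$, $d_v=[L_v:\mathbb{Q}_v]$ denotes the local degree, and $|\cdot|_v$ denotes the absolute value on $L$ extending the usual absolute value of $\mathbb{Q}$ if $v$ is archimedean, and satisfying $|p|_v=1/p$ if $v$ is nonarchimedean lying over the prime $p$. The height of $a\in L$ is $h(a)=\sum_{v}\frac{d_v}{d_L}\log\max\{1,|a|_v\}$, the sum over all places of $L$. For $P=\sum_i a_iX^i\in L[X]$, set $|P|_v=\max_i|a_i|_v$ and $h(P)=\sum_v\frac{d_v}{d_L}\log\max\{1,|P|_v\}$. *)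

theory Defs
  imports
    "HOL-Analysis.Infinite_Sum"
    "HOL-Computational_Algebra.Polynomial"
    "HOL-Computational_Algebra.Primes"
    "HOL-Algebra.QuotRing"
    "HOL-Algebra.Embedded_Algebras"
begin

definition rat_scale :: "rat \<Rightarrow> 'a::field_char_0 \<Rightarrow> 'a" where
  "rat_scale q x = of_rat q * x"

interpretation rat_scale: vector_space "rat_scale :: rat \<Rightarrow> 'a::field_char_0 \<Rightarrow> 'a"
  by unfold_locales (simp_all add: rat_scale_def algebra_simps of_rat_add of_rat_mult)

definition number_field :: "'a::field_char_0 itself \<Rightarrow> bool" where
  "number_field _ \<longleftrightarrow> (\<exists>B::'a set. finite B \<and> rat_scale.span B = UNIV)"

definition field_degree :: "'a::field_char_0 itself \<Rightarrow> nat" where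
  "field_degree _ = rat_scale.dim (UNIV :: 'a set)"

definition absolute_value :: "('a::field \<Rightarrow> real) \<Rightarrow> bool" where
  "absolute_value v \<longleftrightarrow>
     (\<forall>x. 0 \<le> v x) \<and> (\<forall>x. v x = 0 \<longleftrightarrow> x = 0) \<and>
     (\<forall>x y. v (x * y) = v x * v y) \<and> (\<forall>x y. v (x + y) \<le> v x + v y)"

definition nonarchimedean :: "('a::field \<Rightarrow> real) \<Rightarrow> bool" where
  "nonarchimedean v \<longleftrightarrow> (\<forall>x y. v (x + y) \<le> max (v x) (v y))"

text \<open>
  By Ostrowski's theorem, every equivalence class of nontrivial absolute values of a number
  field contains exactly one absolute value normalised as below. A place is identified with
  this absolute value.
\<close>

definition places :: "('a::field_char_0 \<Rightarrow> real) set" where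
  "places = {v. absolute_value v \<and>
     (if nonarchimedean v then \<exists>p::nat. prime p \<and> v (of_nat p) = 1 / real p
      else \<forall>q::rat. v (of_rat q) = \<bar>of_rat q\<bar>)}"

text \<open>
  The completion of a field at an absolute value is the ring of Cauchy sequences modulo the
  ideal of null sequences.
\<close>

definition cauchy_seqs :: "('a::field \<Rightarrow> real) \<Rightarrow> (nat \<Rightarrow> 'a) set" where
  "cauchy_seqs v = {s. \<forall>e>0. \<exists>n0. \<forall>m\<ge>n0. \<forall>n\<ge>n0. v (s m - s n) < e}"

definition null_seqs :: "('a::field \<Rightarrow> real) \<Rightarrow> (nat \<Rightarrow> 'a) set" where
  "null_seqs v = {s. (\<lambda>n. v (s n)) \<longlonglongrightarrow> 0}"

definition cauchy_ring :: "('a::field \<Rightarrow> real) \<Rightarrow> (nat \<Rightarrow> 'a) ring" where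
  "cauchy_ring v =
     \<lparr>carrier = cauchy_seqs v, mult = (\<lambda>s t n. s n * t n), one = (\<lambda>_. 1),
      zero = (\<lambda>_. 0), add = (\<lambda>s t n. s n + t n)\<rparr>"

definition completion :: "('a::field \<Rightarrow> real) \<Rightarrow> (nat \<Rightarrow> 'a) set ring" where
  "completion v = cauchy_ring v Quot null_seqs v"

text \<open>
  The completion of the rationals, realised inside the completion of the ambient field as the
  set of classes of Cauchy sequences of rational numbers.
\<close>

definition rat_completion :: "('a::field_char_0 \<Rightarrow> real) \<Rightarrow> (nat \<Rightarrow> 'a) set set" where
  "rat_completion v =
     (\<lambda>s. null_seqs v +>\<^bsub>cauchy_ring v\<^esub> s) ` {s \<in> cauchy_seqs v. range s \<subseteq> \<rat>}"

definition local_degree :: "('a::field_char_0 \<Rightarrow> real) \<Rightarrow> nat" where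
  "local_degree v = ring.dim (completion v) (rat_completion v) (carrier (completion v))"

definition height :: "'a::field_char_0 \<Rightarrow> real" where
  "height a = (\<Sum>\<^sub>\<infinity>v\<in>places.
     real (local_degree v) / real (field_degree TYPE('a)) * ln (max 1 (v a)))"

definition poly_abs :: "('a::field \<Rightarrow> real) \<Rightarrow> 'a poly \<Rightarrow> real" where
  "poly_abs v P = Max ((\<lambda>i. v (poly.coeff P i)) ` {..degree P})"

definition poly_height :: "'a::field_char_0 poly \<Rightarrow> real" where
  "poly_height P = (\<Sum>\<^sub>\<infinity>v\<in>places.
     real (local_degree v) / real (field_degree TYPE('a)) * ln (max 1 (poly_abs v P)))"

end

theory Submission
  imports Defs "HOL-Analysis.Abstract_Metric_Spaces"
begin

text \<open>
  Locally, F is recovered by Lagrange interpolation at the d + 1 points where it is smallest. The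
  denominators of the interpolation formula are nonzero integers dividing D!, which bounds them at
  every place.

  Globally, the local bounds are summed with the weights \<open>d_v / d_L\<close>. This only needs that the
  local degrees over one place of the rationals add up to at most the global degree. If there were
  more independent elements in the completions than that, weak approximation would yield elements
  of L approximating each of them at its own place and 0 at the others; a rational relation among
  these elements contradicts their independence by compactness of the p-adic (or real) unit ball.
  Convergence of the series for the heights of the values follows from that for F, and if the series
  for F diverges then its height is 0 by convention.
\<close>

section \<open>Absolute values\<close>

text \<open>The local constants reflect the two parts of the interpolation formula. At a
  nonarchimedean place the numerators are integral and only the denominators count. The factor 1 /
  (N - d) is an average: N - d of the points carry values at least as large as every value used in
  the interpolation.

  The obstacle on the global side is that \<open>ring.dim\<close>, hence the local degree, says
  nothing until a finite basis of the completion is known. The comparison with the global degree is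
  therefore made for lengths of independent families; its case of a single place is what produces a
  finite basis.

  Places are grouped by their restriction to the rationals. As the places of a group agree there, a
  rational coefficient that is largest at one of them is largest at all, so a relation can be
  examined at the place to which its largest coefficient belongs.\<close>

locale abs_val =
  fixes v :: "'a::field_char_0 \<Rightarrow> real"
  assumes absolute_value: "absolute_value v"
begin

lemma nonneg [simp]: "0 \<le> v x"
  and eq_0_iff [simp]: "v x = 0 \<longleftrightarrow> x = 0"
  and mult: "v (x * y) = v x * v y"
  and triangle: "v (x + y) \<le> v x + v y"
  using absolute_value unfolding absolute_value_def by auto

lemma zero [simp]: "v 0 = 0"
  by simp

lemma pos_iff [simp]: "0 < v x \<longleftrightarrow> x \<noteq> 0"
  using nonneg[of x] eq_0_iff[of x] by linarith

lemma one [simp]: "v 1 = 1"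
  using mult[of 1 1] by simp

lemma minus [simp]: "v (- x) = v x"
proof -
  have "v (-1) * v (-1) = 1"
    using mult[of "-1" "-1"] by simp
  then have "v (-1) = 1"
    using nonneg[of "-1"] by (metis abs_of_nonneg power2_eq_1_iff power2_eq_square abs_minus_cancel abs_one)
  then show ?thesis
    using mult[of "-1" x] by simp
qed

lemma minus_commute: "v (x - y) = v (y - x)"
  using minus[of "x - y"] by simp

lemma inverse: "v (inverse x) = inverse (v x)"
proof (cases "x = 0")
  case False
  then have "v x * v (inverse x) = 1"
    by (simp flip: mult)
  then show ?thesis
    by (simp add: inverse_unique)
qed simp

lemma divide: "v (x / y) = v x / v y"
  by (simp add: divide_inverse mult inverse)

lemma power: "v (x ^ n) = v x ^ n"
  by (induction n) (auto simp: mult)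

lemma triangle_diff: "v (x - y) \<le> v x + v y"
  using triangle[of x "- y"] by simp

lemma triangle_via: "v (x - z) \<le> v (x - y) + v (y - z)"
  using triangle[of "x - y" "y - z"] by simp

lemma abs_diff_le: "\<bar>v x - v y\<bar> \<le> v (x - y)"
  using triangle[of "x - y" y] triangle[of "y - x" x] by (simp add: minus_commute)

lemma sum_le: "v (sum f S) \<le> (\<Sum>i\<in>S. v (f i))"
proof (induction S rule: infinite_finite_induct)
  case (insert a S)
  then show ?case
    using triangle[of "f a" "sum f S"] by simp
qed auto

end

locale nonarch_abs_val = abs_val +
  assumes nonarchimedean: "nonarchimedean v"
begin

lemma ultrametric: "v (x + y) \<le> max (v x) (v y)"
  using nonarchimedean unfolding nonarchimedean_def by blast

lemma sum_le_bound:
  assumes "\<And>i. i \<in> S \<Longrightarrow> v (f i) \<le> c" "0 \<le> c"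
  shows "v (sum f S) \<le> c"
  using assms
proof (induction S rule: infinite_finite_induct)
  case (insert a S)
  then have "v (f a) \<le> c" "v (sum f S) \<le> c"
    by auto
  then have "v (f a + sum f S) \<le> c"
    using ultrametric[of "f a" "sum f S"] by linarith
  then show ?case
    using insert.hyps by simp
qed auto

lemma of_nat_le_1: "v (of_nat n) \<le> 1"
proof (induction n)
  case (Suc n)
  then show ?case
    using ultrametric[of 1 "of_nat n"] by simp
qed auto

lemma of_int_le_1: "v (of_int n) \<le> 1"
  by (cases n rule: int_cases2) (auto simp: of_nat_le_1)

lemma of_int_dvd_le:
  assumes "m dvd n"
  shows "v (of_int n) \<le> v (of_int m)"
proof -
  obtain k where "n = m * k"
    using assms by blast
  then show ?thesis
    by (simp add: mult mult_left_le of_int_le_1)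
qed

end

section \<open>p-adic absolute values on integers and rationals\<close>

locale padic_abs_val = nonarch_abs_val +
  fixes p :: nat
  assumes prime_p: "prime p"
    and val_p: "v (of_nat p) = 1 / real p"
begin

lemma val_p_less_1: "v (of_nat p) < 1"
  using val_p prime_gt_1_nat[OF prime_p] by simp

text \<open>If n also had absolute value below 1, a Bezout relation between p and n would write 1 as
  a sum of two such elements, against the ultrametric inequality.\<close>

lemma of_int_not_dvd:
  assumes "\<not> int p dvd n"
  shows "v (of_int n) = 1"
proof (rule ccontr)
  assume "v (of_int n) \<noteq> 1"
  then have less: "v (of_int n) < 1"
    using of_int_le_1[of n] by simp
  have "coprime (int p) n"
    using assms prime_p by (simp add: prime_imp_coprime)
  then obtain a b where ab: "a * int p + b * n = 1"
    by (metis bezout_int coprime_iff_gcd_eq_1)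
  have "1 = v (of_int (a * int p + b * n))"
    by (simp only: ab of_int_1 one)
  also have "\<dots> \<le> max (v (of_int (a * int p))) (v (of_int (b * n)))"
    by (simp only: of_int_add ultrametric)
  also have "\<dots> \<le> max (v (of_int (int p))) (v (of_int n))"
    by (intro max.mono of_int_dvd_le) auto
  also have "\<dots> < 1"
    using less val_p_less_1 by simp
  finally show False
    by simp
qed

lemma of_int_eq:
  assumes "n \<noteq> 0"
  shows "v (of_int n) = (1 / real p) ^ multiplicity (int p) n"
proof -
  have "\<not> is_unit (int p)"
    using prime_p by (metis not_prime_unit prime_nat_int_transfer)
  then obtain m where m: "n = int p ^ multiplicity (int p) n * m" "\<not> int p dvd m"
    using multiplicity_decompose'[OF assms, of "int p"] by metis
  have "v (of_int n) = v (of_int (int p ^ multiplicity (int p) n * m))"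
    using m(1) by simp
  also have "\<dots> = (1 / real p) ^ multiplicity (int p) n"
    using of_int_not_dvd[OF m(2)] by (simp add: mult power val_p)
  finally show ?thesis .
qed

text \<open>A rational of absolute value at most 1 has a denominator prime to p, hence invertible
  modulo p^k. The residues modulo p^k therefore form a finite net of the unit ball.\<close>

lemma of_int_approx_of_rat:
  assumes "v (of_rat q) \<le> 1"
  shows "\<exists>c\<in>{0..<int p ^ k}. v (of_rat (q - of_int c)) \<le> (1 / real p) ^ k"
proof -
  obtain a b where ab: "q = Fract a b" "b > 0" "coprime a b"
    by (rule Rat_cases)
  have q: "of_rat q = (of_int a / of_int b :: 'a)"
    using ab by (simp add: of_rat_rat)
  have b: "\<not> int p dvd b"
  proof
    assume *: "int p dvd b"
    then have "\<not> int p dvd a"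
      using ab(3) prime_p by (meson coprime_common_divisor not_prime_unit prime_nat_int_transfer)
    then have "v (of_int a) = 1"
      by (rule of_int_not_dvd)
    moreover have "v (of_int b) < 1"
      using of_int_dvd_le[OF *] val_p_less_1 by simp
    ultimately have "v (of_rat q) > 1"
      using ab(2) by (simp add: q divide)
    then show False
      using assms by simp
  qed
  have "coprime (int p ^ k) b"
    using b prime_p by (simp add: prime_imp_coprime)
  then obtain x y where xy: "x * int p ^ k + y * b = 1"
    by (metis bezout_int coprime_iff_gcd_eq_1)
  \<comment> \<open>\<open>y\<close> inverts the denominator \<open>b\<close> modulo p^k, so
    \<open>c\<close> is the residue of a / b.\<close>
  define c where "c = (y * a) mod int p ^ k"
  have "int p ^ k dvd a - b * c"
  proof -
    have "int p ^ k dvd y * a - c"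
      unfolding c_def by simp
    then have "int p ^ k dvd b * (y * a - c) + a * (x * int p ^ k)"
      by simp
    also have "b * (y * a - c) + a * (x * int p ^ k) = a * (x * int p ^ k + y * b) - b * c"
      by (simp add: algebra_simps)
    finally show ?thesis
      by (simp add: xy)
  qed
  then have "v (of_int (a - b * c)) \<le> v (of_int (int p ^ k))"
    by (rule of_int_dvd_le)
  also have "\<dots> = (1 / real p) ^ k"
    by (simp add: power val_p)
  finally have le: "v (of_int (a - b * c)) \<le> (1 / real p) ^ k" .
  have "of_rat (q - of_int c) = (of_int (a - b * c) / of_int b :: 'a)"
    using ab(2) by (simp add: of_rat_diff q field_simps)
  then have "v (of_rat (q - of_int c)) \<le> (1 / real p) ^ k"
    using le of_int_not_dvd[OF b] by (simp add: divide)
  moreover have "c \<in> {0..<int p ^ k}"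
    using prime_gt_0_nat[OF prime_p] by (simp add: c_def)
  ultimately show ?thesis
    by blast
qed

end

text \<open>On integers both are given by the multiplicity of p, so the prime alone determines the
  restriction to the rationals. This permits grouping the nonarchimedean places by their
  prime.\<close>

lemma padic_of_rat_eq:
  assumes "padic_abs_val v p" "padic_abs_val w p"
  shows "v (of_rat q) = w (of_rat q)"
proof -
  interpret v: padic_abs_val v p by fact
  interpret w: padic_abs_val w p by fact
  obtain a b where ab: "q = Fract a b" "b > 0" "coprime a b"
    by (rule Rat_cases)
  have "v (of_int n) = w (of_int n)" for n
    by (cases "n = 0") (auto simp: v.of_int_eq w.of_int_eq)
  then show ?thesis
    using ab by (simp add: of_rat_rat v.divide w.divide)
qed

section \<open>Places and total boundedness of the rational unit ball\<close>

locale place = abs_val +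
  assumes place: "v \<in> places"
begin

lemma arch_of_rat:
  assumes "\<not> nonarchimedean v"
  shows "v (of_rat q) = \<bar>of_rat q\<bar>"
  using place assms unfolding places_def by auto

lemma arch_of_int:
  assumes "\<not> nonarchimedean v"
  shows "v (of_int n) = \<bar>of_int n\<bar>"
  using arch_of_rat[OF assms, of "of_int n"] by simp

lemma nonarch_padic:
  assumes "nonarchimedean v"
  shows "\<exists>p. padic_abs_val v p"
proof -
  obtain p :: nat where "prime p" "v (of_nat p) = 1 / real p"
    using place assms unfolding places_def by auto
  then have "padic_abs_val v p"
    using assms by unfold_locales auto
  then show ?thesis ..
qed

text \<open>The metric is pulled back to the rationals, where explicit finite nets exist and the
  general theory of totally bounded sets applies to sequences of coefficients.\<close>

sublocale rat_metric: Metric_space UNIV "\<lambda>q r. v (of_rat (q - r))"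
proof
  show "v (of_rat (x - y)) = v (of_rat (y - x))" for x y
    by (simp add: of_rat_diff minus_commute)
  show "v (of_rat (x - z)) \<le> v (of_rat (x - y)) + v (of_rat (y - z))" for x y z
    by (simp add: of_rat_diff triangle_via)
qed auto

text \<open>This stands in for compactness of the unit ball of the completed rationals: it already
  yields Cauchy subsequences, and no limits are formed.\<close>

lemma rat_unit_ball_totally_bounded: "rat_metric.mtotally_bounded {q. v (of_rat q) \<le> 1}"
  unfolding rat_metric.mtotally_bounded_def
proof (intro allI impI)
  fix e :: real
  assume e: "e > 0"
  show "\<exists>K. finite K \<and> K \<subseteq> {q. v (of_rat q) \<le> 1} \<and>
          {q. v (of_rat q) \<le> 1} \<subseteq> (\<Union>x\<in>K. rat_metric.mball x e)"
  proof (cases "nonarchimedean v")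
    case True
    then obtain p where "padic_abs_val v p"
      using nonarch_padic by blast
    then interpret padic_abs_val v p .
    obtain k where k: "(1 / real p) ^ k < e"
      using real_arch_pow_inv[OF e, of "1 / real p"] val_p val_p_less_1 by auto
    show ?thesis
    proof (intro exI[of _ "of_int ` {0..<int p ^ k}"] conjI subsetI)
      fix q :: rat
      assume "q \<in> {q. v (of_rat q) \<le> 1}"
      then obtain c where "c \<in> {0..<int p ^ k}" "v (of_rat (q - of_int c)) < e"
        using of_int_approx_of_rat[of q k] k by force
      then show "q \<in> (\<Union>x\<in>of_int ` {0..<int p ^ k}. rat_metric.mball x e)"
        by (force simp: rat_metric.commute)
    qed (auto simp: of_int_le_1)
  next
    case False
    note [simp] = arch_of_rat[OF False]
    obtain n :: nat where n: "real n > 1 / e"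
      using reals_Archimedean2 by blast
    then have n0: "n > 0"
      using e by (cases n) auto
    have n1: "1 / real n < e"
      using n n0 e by (simp add: field_simps)
    \<comment> \<open>The multiples of 1/n in [-1, 1] form a net of mesh 1/n < e; rounding down
      keeps the index between -n and n.\<close>
    define K where "K = (\<lambda>i. of_int i / of_nat n :: rat) ` {- int n..int n}"
    show ?thesis
    proof (intro exI[of _ K] conjI subsetI)
      show "finite K"
        by (simp add: K_def)
      show "q \<in> {q. v (of_rat q) \<le> 1}" if "q \<in> K" for q
        using that n0 by (auto simp: K_def of_rat_divide)
    next
      fix q :: rat
      assume "q \<in> {q. v (of_rat q) \<le> 1}"
      then have q: "\<bar>of_rat q\<bar> \<le> (1 :: real)"
        by simp
      define i where "i = \<lfloor>of_rat q * real n\<rfloor>"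
      have i: "of_int i \<le> of_rat q * real n" "of_rat q * real n < of_int i + 1"
        unfolding i_def by linarith+
      have "of_rat q \<le> (1 :: real)" "- 1 \<le> (of_rat q :: real)"
        using q by linarith+
      then have "of_rat q * real n \<le> 1 * real n" "- 1 * real n \<le> of_rat q * real n"
        by (intro mult_right_mono; simp)+
      then have "i \<in> {- int n..int n}"
        unfolding i_def by (auto simp: le_floor_iff floor_le_iff)
      moreover have "\<bar>of_rat q - of_int i / real n\<bar> < e"
      proof -
        have "\<bar>of_rat q - of_int i / real n\<bar> = \<bar>of_rat q * real n - of_int i\<bar> / real n"
          using n0 by (simp add: abs_if field_simps)
        also have "\<dots> \<le> 1 / real n"
          using i n0 by (intro divide_right_mono) auto
        finally show ?thesis
          using n1 by simp
      qed
      moreover have "v (of_rat (of_int i / of_nat n - q)) = \<bar>of_rat q - of_int i / real n\<bar>"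
        unfolding arch_of_rat[OF False] by (simp add: of_rat_diff of_rat_divide abs_minus_commute)
      ultimately have "q \<in> rat_metric.mball (of_int i / of_nat n) e" "i \<in> {- int n..int n}"
        unfolding rat_metric.in_mball by simp_all
      then show "q \<in> (\<Union>x\<in>K. rat_metric.mball x e)"
        unfolding K_def by blast
    qed
  qed
qed

lemma rat_MCauchy_iff: "rat_metric.MCauchy s \<longleftrightarrow> (\<lambda>j. of_rat (s j)) \<in> cauchy_seqs v"
  unfolding rat_metric.MCauchy_def cauchy_seqs_def by (auto simp: of_rat_diff)

text \<open>The coordinates are treated one at a time: a subsequence for the new coordinate is
  chosen inside the one already found, and the earlier coordinates stay Cauchy under further
  extraction.\<close>

lemma rat_Cauchy_subseq:
  fixes q :: "nat \<Rightarrow> nat \<Rightarrow> rat"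
  assumes "\<And>i j. i < m \<Longrightarrow> v (of_rat (q i j)) \<le> 1"
  shows "\<exists>r. strict_mono r \<and> (\<forall>i<m. (\<lambda>j. of_rat (q i (r j))) \<in> cauchy_seqs v)"
proof -
  have "\<exists>r. strict_mono r \<and> (\<forall>i<m. rat_metric.MCauchy (q i \<circ> r))"
    using assms
  proof (induction m)
    case 0
    show ?case
      by (auto intro: exI[of _ id] simp: strict_mono_def)
  next
    case (Suc m)
    then obtain r where r: "strict_mono r" "\<And>i. i < m \<Longrightarrow> rat_metric.MCauchy (q i \<circ> r)"
      by (metis less_Suc_eq)
    have "range (q m \<circ> r) \<subseteq> {q. v (of_rat q) \<le> 1}"
      using Suc.prems by auto
    then obtain r' where r': "strict_mono r'" "rat_metric.MCauchy (q m \<circ> r \<circ> r')"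
      using rat_unit_ball_totally_bounded unfolding rat_metric.mtotally_bounded_sequentially by blast
    have "rat_metric.MCauchy (q i \<circ> (r \<circ> r'))" if "i < Suc m" for i
    proof (cases "i = m")
      case True
      then show ?thesis
        using r'(2) by (simp only: o_assoc)
    next
      case False
      then show ?thesis
        using rat_metric.MCauchy_subsequence[OF r'(1), of "q i \<circ> r"] r(2)[of i] that
        by (simp only: o_assoc less_Suc_eq)
    qed
    then show ?case
      using strict_mono_o[OF r(1) r'(1)] by blast
  qed
  then show ?thesis
    by (simp only: rat_MCauchy_iff o_def)
qed

end

section \<open>Completions\<close>

context abs_val
begin

lemma cauchy_seqsD:
  assumes "s \<in> cauchy_seqs v" "e > 0"
  obtains n0 where "\<And>m n. m \<ge> n0 \<Longrightarrow> n \<ge> n0 \<Longrightarrow> v (s m - s n) < e"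
  using assms unfolding cauchy_seqs_def by blast

lemma cauchy_seqs_bounded:
  assumes "s \<in> cauchy_seqs v"
  obtains K where "K > 0" "\<And>n. v (s n) \<le> K"
proof -
  obtain n0 where n0: "\<And>m n. m \<ge> n0 \<Longrightarrow> n \<ge> n0 \<Longrightarrow> v (s m - s n) < 1"
    using cauchy_seqsD[OF assms, of 1] by auto
  define K where "K = (\<Sum>i\<le>n0. v (s i)) + 1"
  have le: "v (s i) \<le> K - 1" if "i \<le> n0" for i
    using that by (auto simp: K_def intro!: member_le_sum)
  have "v (s n) \<le> K" for n
  proof (cases "n \<le> n0")
    case False
    then have "v (s n - s n0) < 1"
      using n0 by simp
    then show ?thesis
      using triangle[of "s n - s n0" "s n0"] le[of n0] by simp
  qed (use le[of n] in simp)
  moreover have "K > 0"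
    using le[of n0] nonneg[of "s n0"] by linarith
  ultimately show thesis
    using that by blast
qed

lemma null_seqs_subset: "null_seqs v \<subseteq> cauchy_seqs v"
proof
  fix s
  assume "s \<in> null_seqs v"
  then have s: "(\<lambda>n. v (s n)) \<longlonglongrightarrow> 0"
    by (simp add: null_seqs_def)
  show "s \<in> cauchy_seqs v"
    unfolding cauchy_seqs_def
  proof (intro CollectI allI impI)
    fix e :: real
    assume "e > 0"
    then obtain n0 where n0: "\<And>n. n \<ge> n0 \<Longrightarrow> v (s n) < e / 2"
      using order_tendstoD(2)[OF s, of "e / 2"] unfolding eventually_sequentially by auto
    have "v (s m - s n) < e" if "m \<ge> n0" "n \<ge> n0" for m n
      using triangle_diff[of "s m" "s n"] n0[OF that(1)] n0[OF that(2)] by linarith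
    then show "\<exists>n0. \<forall>m\<ge>n0. \<forall>n\<ge>n0. v (s m - s n) < e"
      by blast
  qed
qed

lemma null_seqs_squeeze:
  assumes "t \<longlonglongrightarrow> 0" "\<And>n. v (s n) \<le> t n"
  shows "s \<in> null_seqs v"
  unfolding null_seqs_def using assms by (auto intro: Lim_null_comparison[of _ t])

lemma const_in_cauchy_seqs: "(\<lambda>_. c) \<in> cauchy_seqs v"
  by (auto simp: cauchy_seqs_def)

lemma add_in_cauchy_seqs:
  assumes "s \<in> cauchy_seqs v" "t \<in> cauchy_seqs v"
  shows "(\<lambda>n. s n + t n) \<in> cauchy_seqs v"
  unfolding cauchy_seqs_def
proof (intro CollectI allI impI)
  fix e :: real
  assume "e > 0"
  then have e: "e / 2 > 0"
    by simp
  obtain n1 where n1: "\<And>m n. m \<ge> n1 \<Longrightarrow> n \<ge> n1 \<Longrightarrow> v (s m - s n) < e / 2"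
    using cauchy_seqsD[OF assms(1) e] by blast
  obtain n2 where n2: "\<And>m n. m \<ge> n2 \<Longrightarrow> n \<ge> n2 \<Longrightarrow> v (t m - t n) < e / 2"
    using cauchy_seqsD[OF assms(2) e] by blast
  have "v (s m + t m - (s n + t n)) < e" if "m \<ge> max n1 n2" "n \<ge> max n1 n2" for m n
    using triangle[of "s m - s n" "t m - t n"] n1[of m n] n2[of m n] that
    by (simp add: algebra_simps)
  then show "\<exists>n0. \<forall>m\<ge>n0. \<forall>n\<ge>n0. v (s m + t m - (s n + t n)) < e"
    by blast
qed

lemma mult_in_cauchy_seqs:
  assumes "s \<in> cauchy_seqs v" "t \<in> cauchy_seqs v"
  shows "(\<lambda>n. s n * t n) \<in> cauchy_seqs v"
  unfolding cauchy_seqs_def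
proof (intro CollectI allI impI)
  fix e :: real
  assume e: "e > 0"
  obtain K where K: "K > 0" "\<And>n. v (s n) \<le> K"
    using cauchy_seqs_bounded[OF assms(1)] by blast
  obtain L where L: "L > 0" "\<And>n. v (t n) \<le> L"
    using cauchy_seqs_bounded[OF assms(2)] by blast
  obtain n1 where n1: "\<And>m n. m \<ge> n1 \<Longrightarrow> n \<ge> n1 \<Longrightarrow> v (s m - s n) < e / (2 * L)"
    using cauchy_seqsD[OF assms(1), of "e / (2 * L)"] e L by auto
  obtain n2 where n2: "\<And>m n. m \<ge> n2 \<Longrightarrow> n \<ge> n2 \<Longrightarrow> v (t m - t n) < e / (2 * K)"
    using cauchy_seqsD[OF assms(2), of "e / (2 * K)"] e K by auto
  have "v (s m * t m - s n * t n) < e" if "m \<ge> max n1 n2" "n \<ge> max n1 n2" for m n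
  proof -
    have "s m * t m - s n * t n = s m * (t m - t n) + (s m - s n) * t n"
      by (simp add: algebra_simps)
    then have "v (s m * t m - s n * t n) \<le> v (s m) * v (t m - t n) + v (s m - s n) * v (t n)"
      using triangle[of "s m * (t m - t n)" "(s m - s n) * t n"] by (simp add: mult)
    also have "\<dots> \<le> K * v (t m - t n) + v (s m - s n) * L"
      using K L by (intro add_mono mult_right_mono mult_left_mono) auto
    also have "\<dots> < K * (e / (2 * K)) + e / (2 * L) * L"
      using K L n1[of m n] n2[of m n] that
      by (intro add_strict_mono mult_strict_left_mono mult_strict_right_mono) auto
    also have "\<dots> = e"
      using K L by simp
    finally show ?thesis .
  qed
  then show "\<exists>n0. \<forall>m\<ge>n0. \<forall>n\<ge>n0. v (s m * t m - s n * t n) < e"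
    by blast
qed

lemma uminus_in_cauchy_seqs:
  assumes "s \<in> cauchy_seqs v"
  shows "(\<lambda>n. - s n) \<in> cauchy_seqs v"
  using mult_in_cauchy_seqs[OF const_in_cauchy_seqs[of "-1"] assms] by simp

lemma add_in_null_seqs:
  assumes "s \<in> null_seqs v" "t \<in> null_seqs v"
  shows "(\<lambda>n. s n + t n) \<in> null_seqs v"
proof -
  have "(\<lambda>n. v (s n) + v (t n)) \<longlonglongrightarrow> 0 + 0"
    using assms unfolding null_seqs_def by (intro tendsto_add) auto
  then show ?thesis
    by (intro null_seqs_squeeze[of "\<lambda>n. v (s n) + v (t n)"]) (simp_all add: triangle)
qed

lemma mult_in_null_seqs:
  assumes "s \<in> cauchy_seqs v" "t \<in> null_seqs v"
  shows "(\<lambda>n. s n * t n) \<in> null_seqs v"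
proof -
  obtain K where K: "K > 0" "\<And>n. v (s n) \<le> K"
    using cauchy_seqs_bounded[OF assms(1)] by blast
  have "(\<lambda>n. K * v (t n)) \<longlonglongrightarrow> K * 0"
    using assms unfolding null_seqs_def by (intro tendsto_mult) auto
  then show ?thesis
    using K by (intro null_seqs_squeeze[of "\<lambda>n. K * v (t n)"]) (simp_all add: mult mult_right_mono)
qed

text \<open>A Cauchy sequence that is not null stays away from 0 from some index on. Possible zero
  terms before it do no harm, as \<open>inverse 0\<close> is 0 and both claims concern tails
  only.\<close>

lemma inverse_cauchy_seq:
  assumes s: "s \<in> cauchy_seqs v" and nonnull: "s \<notin> null_seqs v"
  shows "(\<lambda>n. inverse (s n)) \<in> cauchy_seqs v"
    and "(\<lambda>n. s n * inverse (s n) - 1) \<in> null_seqs v"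
proof -
  obtain e where e: "e > 0" "\<And>n0. \<exists>n\<ge>n0. v (s n) \<ge> e"
    using nonnull unfolding null_seqs_def LIMSEQ_iff by (auto simp: not_less)
  obtain n0 where n0: "\<And>m n. m \<ge> n0 \<Longrightarrow> n \<ge> n0 \<Longrightarrow> v (s m - s n) < e / 2"
    using cauchy_seqsD[OF s, of "e / 2"] e by auto
  obtain k where k: "k \<ge> n0" "v (s k) \<ge> e"
    using e(2) by blast
  \<comment> \<open>The term with index k has size at least e, and all terms from n0 on differ from
    it by less than e / 2.\<close>
  have ge: "v (s n) \<ge> e / 2" if "n \<ge> n0" for n
    using abs_diff_le[of "s k" "s n"] n0[of k n] k that by linarith
  have nz: "s n \<noteq> 0" if "n \<ge> n0" for n
    using ge[OF that] e by auto
  show "(\<lambda>n. inverse (s n)) \<in> cauchy_seqs v"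
    unfolding cauchy_seqs_def
  proof (intro CollectI allI impI)
    fix e' :: real
    assume e': "e' > 0"
    \<comment> \<open>The square pays for the denominator \<open>s m * s n\<close>, which is at
      least (e / 2)^2 in absolute value.\<close>
    then obtain n1 where n1: "\<And>m n. m \<ge> n1 \<Longrightarrow> n \<ge> n1 \<Longrightarrow> v (s m - s n) < e' * (e / 2)\<^sup>2"
      using cauchy_seqsD[OF s, of "e' * (e / 2)\<^sup>2"] e by auto
    have "v (inverse (s m) - inverse (s n)) < e'" if "m \<ge> max n0 n1" "n \<ge> max n0 n1" for m n
    proof -
      have nz': "s m \<noteq> 0" "s n \<noteq> 0"
        using nz that by auto
      then have "inverse (s m) - inverse (s n) = (s n - s m) / (s m * s n)"
        by (simp add: field_simps)
      then have "v (inverse (s m) - inverse (s n)) = v (s n - s m) / (v (s m) * v (s n))"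
        by (simp add: divide mult)
      also have "\<dots> \<le> v (s n - s m) / (e / 2)\<^sup>2"
      proof (intro divide_left_mono)
        show "(e / 2)\<^sup>2 \<le> v (s m) * v (s n)"
          unfolding power2_eq_square using ge[of m] ge[of n] that e by (intro mult_mono) auto
      qed (use nz' e in auto)
      also have "\<dots> < e'"
        using n1[of n m] that e by (simp add: pos_divide_less_eq)
      finally show ?thesis .
    qed
    then show "\<exists>n0. \<forall>m\<ge>n0. \<forall>n\<ge>n0. v (inverse (s m) - inverse (s n)) < e'"
      by blast
  qed
  have "eventually (\<lambda>n. v (s n * inverse (s n) - 1) = 0) sequentially"
    using nz unfolding eventually_sequentially by (intro exI[of _ n0]) auto
  then show "(\<lambda>n. s n * inverse (s n) - 1) \<in> null_seqs v"
    unfolding null_seqs_def mem_Collect_eq by (rule tendsto_eventually)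
qed

section \<open>The completion as a quotient of the ring of Cauchy sequences\<close>

lemma cauchy_ring_simps [simp]:
  "carrier (cauchy_ring v) = cauchy_seqs v"
  "s \<otimes>\<^bsub>cauchy_ring v\<^esub> t = (\<lambda>n. s n * t n)"
  "s \<oplus>\<^bsub>cauchy_ring v\<^esub> t = (\<lambda>n. s n + t n)"
  "\<one>\<^bsub>cauchy_ring v\<^esub> = (\<lambda>_. 1)"
  "\<zero>\<^bsub>cauchy_ring v\<^esub> = (\<lambda>_. 0)"
  by (simp_all add: cauchy_ring_def)

lemma cring_cauchy_ring: "cring (cauchy_ring v)"
proof (intro cringI abelian_groupI comm_monoidI)
  fix x
  assume "x \<in> carrier (cauchy_ring v)"
  then show "\<exists>y\<in>carrier (cauchy_ring v). y \<oplus>\<^bsub>cauchy_ring v\<^esub> x = \<zero>\<^bsub>cauchy_ring v\<^esub>"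
    by (intro bexI[of _ "\<lambda>n. - x n"]) (auto simp: uminus_in_cauchy_seqs)
qed (auto simp: const_in_cauchy_seqs add_in_cauchy_seqs mult_in_cauchy_seqs algebra_simps)

sublocale C: cring "cauchy_ring v"
  by (rule cring_cauchy_ring)

lemma cauchy_ring_uminus:
  assumes "s \<in> cauchy_seqs v"
  shows "\<ominus>\<^bsub>cauchy_ring v\<^esub> s = (\<lambda>n. - s n)"
  using assms by (intro C.minus_equality) (auto simp: uminus_in_cauchy_seqs)

lemma ideal_null_seqs: "ideal (null_seqs v) (cauchy_ring v)"
proof (rule idealI)
  show "subgroup (null_seqs v) (add_monoid (cauchy_ring v))"
  proof (rule C.add.subgroupI)
    show "null_seqs v \<noteq> {}"
      unfolding null_seqs_def by (auto intro!: exI[of _ "\<lambda>_. 0"])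
    fix s
    assume s: "s \<in> null_seqs v"
    then show "\<ominus>\<^bsub>cauchy_ring v\<^esub> s \<in> null_seqs v"
      using null_seqs_subset by (subst cauchy_ring_uminus) (blast, simp add: null_seqs_def)
  qed (simp_all add: add_in_null_seqs null_seqs_subset)
next
  fix a x
  assume "a \<in> null_seqs v" "x \<in> carrier (cauchy_ring v)"
  then have "(\<lambda>n. x n * a n) \<in> null_seqs v"
    by (simp add: mult_in_null_seqs)
  then show "x \<otimes>\<^bsub>cauchy_ring v\<^esub> a \<in> null_seqs v" "a \<otimes>\<^bsub>cauchy_ring v\<^esub> x \<in> null_seqs v"
    by (simp_all add: mult.commute)
qed (rule C.ring_axioms)

sublocale I: ideal "null_seqs v" "cauchy_ring v"
  by (rule ideal_null_seqs)

definition coset :: "(nat \<Rightarrow> 'a) \<Rightarrow> (nat \<Rightarrow> 'a) set" where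
  "coset s = null_seqs v +>\<^bsub>cauchy_ring v\<^esub> s"

sublocale Q: cring "completion v"
  unfolding completion_def by (rule I.quotient_is_cring[OF cring_cauchy_ring])

sublocale h: ring_hom_ring "cauchy_ring v" "completion v" coset
  using I.rcos_ring_hom_ring unfolding completion_def coset_def[abs_def] .

lemma coset_eq_zero_iff:
  assumes "s \<in> cauchy_seqs v"
  shows "coset s = \<zero>\<^bsub>completion v\<^esub> \<longleftrightarrow> s \<in> null_seqs v"
proof -
  have "\<zero>\<^bsub>completion v\<^esub> = null_seqs v"
    by (simp add: completion_def FactRing_def)
  moreover have "coset s = null_seqs v \<longleftrightarrow> s \<in> null_seqs v"
    unfolding coset_def
    using assms C.a_rcos_zero[OF ideal_null_seqs, of s] I.rcos_const_imp_mem[of s]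
    by (metis cauchy_ring_simps(1))
  ultimately show ?thesis
    by simp
qed

lemma carrier_completion: "carrier (completion v) = coset ` cauchy_seqs v"
  by (auto simp: completion_def FactRing_def A_RCOSETS_def' coset_def)

lemma rat_completion_eq: "rat_completion v = coset ` {s \<in> cauchy_seqs v. range s \<subseteq> \<rat>}"
  by (simp add: rat_completion_def coset_def[abs_def])

text \<open>The dimension theory behind the local degree takes its scalars from a subfield of a
  ring. Termwise inverses of rational sequences are rational, so nonzero classes have inverses of
  the same kind.\<close>

lemma subfield_rat_completion: "subfield (rat_completion v) (completion v)"
proof (rule Q.subfieldI)
  let ?K = "{s \<in> cauchy_seqs v. range s \<subseteq> \<rat>}"
  have "subring ?K (cauchy_ring v)"
  proof (rule C.subringI)
    fix s
    assume "s \<in> ?K"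
    then show "\<ominus>\<^bsub>cauchy_ring v\<^esub> s \<in> ?K"
      by (auto simp: cauchy_ring_uminus uminus_in_cauchy_seqs image_subset_iff)
  qed (auto simp: const_in_cauchy_seqs mult_in_cauchy_seqs add_in_cauchy_seqs image_subset_iff)
  then have subring: "subring (rat_completion v) (completion v)"
    unfolding rat_completion_eq by (rule h.img_is_subring)
  show "subcring (rat_completion v) (completion v)"
    by (rule Q.subcringI'[OF subring])
  have one_nz: "\<one>\<^bsub>completion v\<^esub> \<noteq> \<zero>\<^bsub>completion v\<^esub>"
  proof -
    have "(\<lambda>_. 1) \<notin> null_seqs v"
      by (simp add: null_seqs_def LIMSEQ_const_iff)
    then have "coset (\<lambda>_. 1) \<noteq> \<zero>\<^bsub>completion v\<^esub>"
      by (subst coset_eq_zero_iff) (auto simp: const_in_cauchy_seqs)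
    then show ?thesis
      using h.hom_one by simp
  qed
  show "Units (completion v\<lparr>carrier := rat_completion v\<rparr>) = rat_completion v - {\<zero>\<^bsub>completion v\<^esub>}"
  proof (intro equalityI subsetI)
    fix x
    assume "x \<in> Units (completion v\<lparr>carrier := rat_completion v\<rparr>)"
    then obtain y where "x \<in> rat_completion v" "y \<in> rat_completion v"
      "y \<otimes>\<^bsub>completion v\<^esub> x = \<one>\<^bsub>completion v\<^esub>"
      by (auto simp: Units_def)
    then show "x \<in> rat_completion v - {\<zero>\<^bsub>completion v\<^esub>}"
      using one_nz subringE(1)[OF subring] by auto
  next
    fix x
    assume x: "x \<in> rat_completion v - {\<zero>\<^bsub>completion v\<^esub>}"
    then obtain s where s: "s \<in> cauchy_seqs v" "range s \<subseteq> \<rat>" "x = coset s"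
      by (auto simp: rat_completion_eq)
    then have "s \<notin> null_seqs v"
      using x coset_eq_zero_iff by auto
    note inv = inverse_cauchy_seq[OF s(1) this]
    let ?t = "\<lambda>n. inverse (s n)"
    have t: "coset ?t \<in> rat_completion v"
      using inv(1) s(2) by (auto simp: rat_completion_eq image_subset_iff intro!: imageI)
    have "s \<otimes>\<^bsub>cauchy_ring v\<^esub> ?t \<ominus>\<^bsub>cauchy_ring v\<^esub> \<one>\<^bsub>cauchy_ring v\<^esub> \<in> null_seqs v"
      using inv(2) by (simp add: a_minus_def cauchy_ring_uminus const_in_cauchy_seqs)
    then have "coset (s \<otimes>\<^bsub>cauchy_ring v\<^esub> ?t) = coset \<one>\<^bsub>cauchy_ring v\<^esub>"
      unfolding coset_def using inv(1) s(1)
      by (subst C.quotient_eq_iff_same_a_r_cos[OF ideal_null_seqs, symmetric])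
        (auto simp: const_in_cauchy_seqs mult_in_cauchy_seqs)
    then have "x \<otimes>\<^bsub>completion v\<^esub> coset ?t = \<one>\<^bsub>completion v\<^esub>"
      using inv(1) s by (simp only: h.hom_mult h.hom_one cauchy_ring_simps(1))
    moreover have "coset ?t \<otimes>\<^bsub>completion v\<^esub> x = x \<otimes>\<^bsub>completion v\<^esub> coset ?t"
      using x t subringE(1)[OF subring] by (intro Q.m_comm) auto
    ultimately show "x \<in> Units (completion v\<lparr>carrier := rat_completion v\<rparr>)"
      using x t by (auto simp: Units_def)
  qed
qed

section \<open>Linear independence over the completed rationals\<close>

lemma combine_cauchy_ring:
  assumes "length cs = length ss"
  shows "C.combine cs ss = (\<lambda>n. \<Sum>i<length ss. (cs ! i) n * (ss ! i) n)"
  using assms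
proof (induction cs ss rule: list_induct2)
  case (Cons c cs s ss)
  then show ?case
    by (simp add: sum.lessThan_Suc_shift del: sum.lessThan_Suc)
qed simp

text \<open>This removes the quotient from later arguments: independence of classes becomes a
  statement about representing sequences, with null sequences in the role of 0 and rational Cauchy
  sequences as scalars.\<close>

lemma independent_cauchy_seqs:
  assumes "Q.independent (rat_completion v) Us"
  obtains s where "\<And>i. i < length Us \<Longrightarrow> s i \<in> cauchy_seqs v"
    and "\<And>c. \<forall>i<length Us. c i \<in> cauchy_seqs v \<and> range (c i) \<subseteq> \<rat> \<Longrightarrow>
           (\<lambda>n. \<Sum>i<length Us. c i n * s i n) \<in> null_seqs v \<Longrightarrow>
           \<forall>i<length Us. c i \<in> null_seqs v"
proof -
  have "\<exists>s. s \<in> cauchy_seqs v \<and> Us ! i = coset s" if "i < length Us" for i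
    using Q.independent_in_carrier[OF assms] that carrier_completion by (auto simp: set_conv_nth)
  then obtain s where s: "\<And>i. i < length Us \<Longrightarrow> s i \<in> cauchy_seqs v \<and> Us ! i = coset (s i)"
    by metis
  define ss where "ss = map s [0..<length Us]"
  have Us: "Us = map coset ss"
    using s by (auto simp: ss_def intro!: nth_equalityI)
  have "\<forall>i<length Us. c i \<in> null_seqs v"
    if c: "\<forall>i<length Us. c i \<in> cauchy_seqs v \<and> range (c i) \<subseteq> \<rat>"
      and null: "(\<lambda>n. \<Sum>i<length Us. c i n * s i n) \<in> null_seqs v" for c
  proof (intro allI impI)
    fix i
    assume i: "i < length Us"
    define cs where "cs = map c [0..<length Us]"
    have sub: "set cs \<subseteq> cauchy_seqs v" "set ss \<subseteq> cauchy_seqs v"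
      using c s by (auto simp: cs_def ss_def)
    have comb: "C.combine cs ss \<in> null_seqs v"
      using null by (simp add: combine_cauchy_ring cs_def ss_def)
    have "Q.combine (map coset cs) Us = coset (C.combine cs ss)"
      unfolding Us using sub by (intro h.combine_hom) auto
    also have "\<dots> = \<zero>\<^bsub>completion v\<^esub>"
      using comb null_seqs_subset coset_eq_zero_iff by blast
    finally have *: "Q.combine (map coset cs) Us = \<zero>\<^bsub>completion v\<^esub>" .
    have "set (map coset cs) \<subseteq> rat_completion v"
      using c by (auto simp: cs_def rat_completion_eq)
    from Q.independent_imp_trivial_combine[OF subfield_rat_completion assms this *]
    have "set (map coset cs) \<subseteq> {\<zero>\<^bsub>completion v\<^esub>}"
      by (simp add: cs_def)
    then have "coset (c i) = \<zero>\<^bsub>completion v\<^esub>"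
      using i by (simp add: cs_def image_subset_iff)
    then show "c i \<in> null_seqs v"
      using coset_eq_zero_iff c i by blast
  qed
  moreover have "s i \<in> cauchy_seqs v" if "i < length Us" for i
    using s that by blast
  ultimately show thesis
    by (rule that[rotated])
qed

text \<open>A uniform bound on lengths provides an independent family of greatest length. An element
  outside its span could be added to it, so it is a basis and \<open>local_degree\<close> has its
  intended meaning.\<close>

lemma local_degree_eq_length_independent:
  assumes "\<And>Us. Q.independent (rat_completion v) Us \<Longrightarrow> length Us \<le> n"
  obtains Us where "Q.independent (rat_completion v) Us" "length Us = local_degree v"
proof -
  obtain Us where Us: "Q.independent (rat_completion v) Us"
    and max: "\<And>Vs. Q.independent (rat_completion v) Vs \<Longrightarrow> length Vs \<le> length Us"
    using ex_has_greatest_nat[of "Q.independent (rat_completion v)" "[]" length "Suc n"] assms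
    by (metis Q.li_Nil le_imp_less_Suc)
  have "Q.Span (rat_completion v) Us = carrier (completion v)"
  proof (intro equalityI subsetI)
    fix u
    assume u: "u \<in> carrier (completion v)"
    show "u \<in> Q.Span (rat_completion v) Us"
    proof (rule ccontr)
      assume "u \<notin> Q.Span (rat_completion v) Us"
      then have "Q.independent (rat_completion v) (u # Us)"
        using u Us by (intro Q.li_Cons)
      then show False
        using max[of "u # Us"] by simp
    qed
  qed (use Q.Span_in_carrier[OF subringE(1)[OF subfieldE(1)[OF subfield_rat_completion]]
        Q.independent_in_carrier[OF Us]] in blast)
  then have "Q.dimension (length Us) (rat_completion v) (carrier (completion v))"
    using Q.dimension_independent[OF Us] by simp
  then have "local_degree v = length Us"
    using Q.dimI[OF subfield_rat_completion] unfolding local_degree_def over_def by blast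
  then show thesis
    using that Us by simp
qed

end

section \<open>Local degrees\<close>

lemma finite_ex_maximum:
  fixes f :: "'i \<Rightarrow> real"
  assumes "finite A" "A \<noteq> {}"
  shows "\<exists>x\<in>A. \<forall>y\<in>A. f y \<le> f x"
proof -
  obtain x where "x \<in> A" "Max (f ` A) = f x"
    using obtains_MAX[OF assms] by blast
  then show ?thesis
    using assms by (metis Max_ge finite_imageI imageI)
qed

text \<open>
  Compactness of the unit ball of the completed rationals shows that a small rational combination
  of approximations to independent elements has small coefficients.
\<close>

lemma (in place) independent_lower_bound:
  fixes s :: "nat \<Rightarrow> nat \<Rightarrow> 'a"
  assumes s: "\<And>i. i < m \<Longrightarrow> s i \<in> cauchy_seqs v"
    and indep: "\<And>c. \<forall>i<m. c i \<in> cauchy_seqs v \<and> range (c i) \<subseteq> \<rat> \<Longrightarrow>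
           (\<lambda>n. \<Sum>i<m. c i n * s i n) \<in> null_seqs v \<Longrightarrow> \<forall>i<m. c i \<in> null_seqs v"
  shows "\<exists>e \<delta>. \<delta> > 0 \<and> (\<forall>q. \<forall>i<m. \<delta> * v (of_rat (q i)) \<le> v (\<Sum>i<m. of_rat (q i) * e i))"
proof (rule ccontr)
  assume "\<not> ?thesis"
  then have neg: "\<exists>q. \<exists>i<m. v (\<Sum>j<m. of_rat (q j) * e j) < \<delta> * v (of_rat (q i))" if "\<delta> > 0" for e \<delta>
    using that by (metis not_le)
  \<comment> \<open>The negated bound is used for the k-th terms of the sequences with \<delta> = 1
    / (k + 1). Dividing by a coefficient of largest absolute value turns that one into 1 and puts
    the others into the unit ball.\<close>
  have "\<exists>q i. i < m \<and> q i = 1 \<and> (\<forall>j<m. v (of_rat (q j)) \<le> 1) \<and>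
          v (\<Sum>j<m. of_rat (q j) * s j k) < 1 / real (Suc k)" for k
  proof -
    obtain q i where i: "i < m"
      and qi: "v (\<Sum>j<m. of_rat (q j) * s j k) < 1 / real (Suc k) * v (of_rat (q i))"
      using neg[of "1 / real (Suc k)" "\<lambda>j. s j k"] by auto
    obtain l where l: "l < m" and max: "\<And>j. j < m \<Longrightarrow> v (of_rat (q j)) \<le> v (of_rat (q l))"
      using finite_ex_maximum[of "{..<m}" "\<lambda>j. v (of_rat (q j))"] i
      by (metis emptyE finite_lessThan lessThan_iff)
    have small: "v (\<Sum>j<m. of_rat (q j) * s j k) < 1 / real (Suc k) * v (of_rat (q l))"
      by (rule order_less_le_trans[OF qi mult_left_mono[OF max[OF i]]]) simp
    have pos: "0 < v (of_rat (q l))"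
    proof (rule ccontr)
      assume "\<not> 0 < v (of_rat (q l))"
      then have "v (of_rat (q l)) = 0"
        using nonneg[of "of_rat (q l)"] by linarith
      then show False
        using small nonneg[of "\<Sum>j<m. of_rat (q j) * s j k"] by simp
    qed
    then have nz: "q l \<noteq> 0"
      by auto
    have "(\<Sum>j<m. of_rat (q j / q l) * s j k) = (\<Sum>j<m. of_rat (q j) * s j k) / of_rat (q l)"
      by (simp add: of_rat_divide sum_divide_distrib)
    then have "v (\<Sum>j<m. of_rat (q j / q l) * s j k) < 1 / real (Suc k)"
      using small pos by (simp add: divide pos_divide_less_eq)
    moreover have "v (of_rat (q j / q l)) \<le> 1" if "j < m" for j
      using max[OF that] pos by (simp add: of_rat_divide divide)
    ultimately show ?thesis
      using l nz by (intro exI[of _ "\<lambda>j. q j / q l"] exI[of _ l]) simp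
  qed
  then obtain q l where l: "\<And>k. l k < m" and ql: "\<And>k. q k (l k) = 1"
    and q1: "\<And>k j. j < m \<Longrightarrow> v (of_rat (q k j)) \<le> 1"
    and small: "\<And>k. v (\<Sum>j<m. of_rat (q k j) * s j k) < 1 / real (Suc k)"
    by metis
  obtain r where r: "strict_mono r"
    and cauchy: "\<And>i. i < m \<Longrightarrow> (\<lambda>j. of_rat (q (r j) i)) \<in> cauchy_seqs v"
    using rat_Cauchy_subseq[of m "\<lambda>i j. q j i"] q1 by blast
  define c where "c i n = (of_rat (q (r n) i) :: 'a)" for i n
  have null_diff: "(\<lambda>n. v (s i n - s i (r n))) \<longlonglongrightarrow> 0" if i: "i < m" for i
    unfolding LIMSEQ_iff
  proof (intro allI impI)
    fix e :: real
    assume "e > 0"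
    then obtain n0 where n0: "\<And>m n. m \<ge> n0 \<Longrightarrow> n \<ge> n0 \<Longrightarrow> v (s i m - s i n) < e"
      using cauchy_seqsD[OF s[OF i]] by blast
    have "r n \<ge> n0" if "n \<ge> n0" for n
      using seq_suble[OF r, of n] that by linarith
    then show "\<exists>n0. \<forall>n\<ge>n0. norm (v (s i n - s i (r n)) - 0) < e"
      using n0 by (intro exI[of _ n0]) auto
  qed
  \<comment> \<open>The coefficients \<open>c i n\<close> belong to the index \<open>r n\<close>,
    where the combination is small. The sequences being Cauchy and the coefficients bounded by 1,
    replacing \<open>s i (r n)\<close> by \<open>s i n\<close> costs only a null sequence.\<close>
  have "(\<lambda>n. \<Sum>i<m. c i n * s i n) \<in> null_seqs v"
  proof (rule null_seqs_squeeze)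
    have "(\<lambda>n. 1 / real (Suc n) + (\<Sum>i<m. v (s i n - s i (r n)))) \<longlonglongrightarrow> 0 + (\<Sum>i<m. 0)"
      using null_diff by (intro tendsto_add tendsto_sum LIMSEQ_Suc[OF lim_1_over_n]) auto
    then show "(\<lambda>n. 1 / real (Suc n) + (\<Sum>i<m. v (s i n - s i (r n)))) \<longlonglongrightarrow> 0"
      by simp
    fix n
    have "(\<Sum>i<m. c i n * s i n) = (\<Sum>i<m. c i n * s i (r n)) + (\<Sum>i<m. c i n * (s i n - s i (r n)))"
      by (simp add: algebra_simps sum_subtractf)
    then have "v (\<Sum>i<m. c i n * s i n) \<le>
        v (\<Sum>i<m. c i n * s i (r n)) + v (\<Sum>i<m. c i n * (s i n - s i (r n)))"
      using triangle by simp
    moreover have "v (\<Sum>i<m. c i n * s i (r n)) \<le> 1 / real (Suc n)"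
    proof -
      have "v (\<Sum>i<m. c i n * s i (r n)) \<le> 1 / real (Suc (r n))"
        using small[of "r n"] by (simp add: c_def)
      also have "\<dots> \<le> 1 / real (Suc n)"
        using seq_suble[OF r, of n] by (intro divide_left_mono) auto
      finally show ?thesis .
    qed
    moreover have "v (\<Sum>i<m. c i n * (s i n - s i (r n))) \<le> (\<Sum>i<m. v (s i n - s i (r n)))"
    proof -
      have "v (\<Sum>i<m. c i n * (s i n - s i (r n))) \<le> (\<Sum>i<m. v (c i n * (s i n - s i (r n))))"
        by (rule sum_le)
      also have "\<dots> \<le> (\<Sum>i<m. v (s i n - s i (r n)))"
        using q1 by (intro sum_mono) (simp add: mult c_def mult_left_le_one_le)
      finally show ?thesis .
    qed
    ultimately show "v (\<Sum>i<m. c i n * s i n) \<le> 1 / real (Suc n) + (\<Sum>i<m. v (s i n - s i (r n)))"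
      by linarith
  qed
  moreover have "c i \<in> cauchy_seqs v \<and> range (c i) \<subseteq> \<rat>" if "i < m" for i
    using cauchy[OF that] unfolding c_def[abs_def] by auto
  ultimately have null: "c i \<in> null_seqs v" if "i < m" for i
    using indep[of c] that by blast
  \<comment> \<open>Which coefficient equals 1 may vary with n, so the contradiction needs an n at
    which all m coefficients are below 1 simultaneously.\<close>
  have "eventually (\<lambda>n. v (c i n) < 1) sequentially" if "i \<in> {..<m}" for i
    using null[of i] that order_tendstoD(2)[of "\<lambda>n. v (c i n)" 0 sequentially 1]
    by (simp add: null_seqs_def)
  then have "eventually (\<lambda>n. \<forall>i\<in>{..<m}. v (c i n) < 1) sequentially"
    by (intro eventually_ball_finite) auto
  then obtain n where "\<forall>i\<in>{..<m}. v (c i n) < 1"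
    unfolding eventually_sequentially by blast
  then have "v (c (l (r n)) n) < 1"
    using l by blast
  then show False
    using ql by (simp add: c_def)
qed

subsection \<open>Weak approximation\<close>

context abs_val
begin

lemma power_int: "v (x powi n) = v x powi n"
  by (simp add: power_int_def power inverse)

text \<open>The sequence a^n / (1 + a^n) acts as a switch: it tends to 0 where a is small and, by
  \<open>frac_power_tendsto_1\<close>, to 1 where a is large. The same elements thus serve several
  places at once.\<close>

lemma frac_power_tendsto_0:
  assumes "v a < 1"
  shows "(\<lambda>n. v (a ^ n / (1 + a ^ n))) \<longlonglongrightarrow> 0"
proof (rule Lim_null_comparison)
  have "(\<lambda>n. v a ^ n / (1 - v a ^ n)) \<longlonglongrightarrow> 0 / (1 - 0)"
    using assms by (intro tendsto_intros LIMSEQ_realpow_zero) auto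
  then show "(\<lambda>n. v a ^ n / (1 - v a ^ n)) \<longlonglongrightarrow> 0"
    by simp
  show "eventually (\<lambda>n. norm (v (a ^ n / (1 + a ^ n))) \<le> v a ^ n / (1 - v a ^ n)) sequentially"
    unfolding eventually_sequentially
  \<comment> \<open>The index 0 is left out, since the bound has denominator 1 - 1 there.\<close>
  proof (intro exI[of _ 1] allI impI)
    fix n :: nat
    assume "n \<ge> 1"
    then have less: "v a ^ n < 1"
      using assms by (simp add: power_less_one_iff)
    have ge: "v (1 + a ^ n) \<ge> 1 - v a ^ n"
      using triangle[of "1 + a ^ n" "- (a ^ n)"] by (simp add: power)
    then have "v a ^ n / v (1 + a ^ n) \<le> v a ^ n / (1 - v a ^ n)"
      using less by (intro divide_left_mono mult_pos_pos) (simp, simp, linarith, linarith)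
    then show "norm (v (a ^ n / (1 + a ^ n))) \<le> v a ^ n / (1 - v a ^ n)"
      by (simp add: divide power)
  qed
qed

text \<open>Up to sign, the distance to 1 is the same switch formed with the inverse of a.\<close>

lemma frac_power_tendsto_1:
  assumes "v a > 1"
  shows "(\<lambda>n. v (a ^ n / (1 + a ^ n) - 1)) \<longlonglongrightarrow> 0"
proof -
  have "v (inverse a) < 1"
    using assms by (simp add: inverse inverse_less_1_iff)
  then have "(\<lambda>n. v (inverse a ^ n / (1 + inverse a ^ n))) \<longlonglongrightarrow> 0"
    by (rule frac_power_tendsto_0)
  moreover have "eventually (\<lambda>n. v (inverse a ^ n / (1 + inverse a ^ n)) =
      v (a ^ n / (1 + a ^ n) - 1)) sequentially"
    unfolding eventually_sequentially
  proof (intro exI[of _ 1] allI impI)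
    fix n :: nat
    assume "n \<ge> 1"
    then have gt: "v a ^ n > 1"
      using assms by (simp add: one_less_power)
    have "v (1 + a ^ n) \<ge> -1 + v a ^ n"
      using triangle[of "1 + a ^ n" "-1"] by (simp add: power)
    then have nz: "1 + a ^ n \<noteq> 0"
      using gt by auto
    moreover have "a \<noteq> 0"
      using assms by auto
    ultimately have "inverse a ^ n / (1 + inverse a ^ n) = 1 / (1 + a ^ n)"
      by (simp add: field_simps)
    also have "\<dots> = 1 - a ^ n / (1 + a ^ n)"
      using nz by (simp add: field_simps)
    finally show "v (inverse a ^ n / (1 + inverse a ^ n)) = v (a ^ n / (1 + a ^ n) - 1)"
      by (simp add: minus_commute)
  qed
  ultimately show ?thesis
    by (rule Lim_transform_eventually)
qed

end

lemma place_locale: "v \<in> places \<Longrightarrow> place v"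
  by unfold_locales (auto simp: places_def)

text \<open>For a set of places this encodes lying over one common place of the rationals.\<close>

definition same_on_rats :: "('a::field_char_0 \<Rightarrow> real) set \<Rightarrow> bool" where
  "same_on_rats S \<longleftrightarrow> (\<forall>v\<in>S. \<forall>w\<in>S. \<forall>q. v (of_rat q) = w (of_rat q))"

lemma same_on_ratsD:
  "same_on_rats S \<Longrightarrow> v \<in> S \<Longrightarrow> w \<in> S \<Longrightarrow> v (of_rat q) = w (of_rat q)"
  unfolding same_on_rats_def by blast

lemma same_on_rats_subset: "same_on_rats T \<Longrightarrow> S \<subseteq> T \<Longrightarrow> same_on_rats S"
  unfolding same_on_rats_def by blast

text \<open>Distinct places differ at some x; if they agree on the rationals, a rational factor can
  move the threshold 1 between the two values of x. Rational absolute values are dense in the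
  archimedean case. In the p-adic case they are only powers of p, so x is replaced by a power of x
  at which the two values differ by more than a factor p.\<close>

lemma separate_two_places:
  fixes v w :: "'a::field_char_0 \<Rightarrow> real"
  assumes "v \<in> places" "w \<in> places" "v \<noteq> w" "same_on_rats {v, w}"
  shows "\<exists>y. v y > 1 \<and> w y < 1"
proof -
  interpret v: place v using assms by (intro place_locale)
  interpret w: place w using assms by (intro place_locale)
  have same: "v (of_rat q) = w (of_rat q)" for q
    using same_on_ratsD[OF assms(4)] by blast
  obtain x0 where x0: "v x0 \<noteq> w x0"
    using assms(3) by auto
  then have "x0 \<noteq> 0"
    by auto
  obtain x where x: "w x < v x" "x \<noteq> 0"
  proof (cases "w x0 < v x0")
    case True
    then show ?thesis
      using that \<open>x0 \<noteq> 0\<close> by blast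
  next
    case False
    then have "inverse (w x0) < inverse (v x0)"
      using x0 \<open>x0 \<noteq> 0\<close> by (intro less_imp_inverse_less) auto
    then show ?thesis
      using that[of "inverse x0"] \<open>x0 \<noteq> 0\<close> by (simp add: v.inverse w.inverse)
  qed
  show ?thesis
  proof (cases "nonarchimedean v")
    case False
    obtain q where q: "w x < real_of_rat q" "real_of_rat q < v x"
      using of_rat_dense[OF x(1)] by blast
    then have "real_of_rat q > 0"
      using w.nonneg[of x] by linarith
    then have "v (of_rat q) = real_of_rat q"
      using v.arch_of_rat[OF False] by simp
    then have "v (x / of_rat q) > 1" "w (x / of_rat q) < 1"
      using q \<open>real_of_rat q > 0\<close> by (auto simp: v.divide w.divide same)
    then show ?thesis
      by blast
  next
    case True
    then obtain p where "padic_abs_val v p"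
      using v.nonarch_padic by blast
    then interpret padic_abs_val v p .
    have p: "real p > 1"
      using prime_gt_1_nat[OF prime_p] by simp
    have wp: "w (of_nat p) = 1 / real p"
      using same[of "of_nat p"] val_p by simp
    have pos: "w x > 0" "v x > 0"
      using x(2) by auto
    obtain n where n: "real p < (v x / w x) ^ n"
      using real_arch_pow[of "v x / w x" "real p"] x(1) pos by auto
    \<comment> \<open>The least integer k with p^k > w(x)^n; the floor plus 1 makes the inequality
      strict. As p has absolute value 1/p at both places, multiplying by p^k divides both values by
      p^k.\<close>
    define k where "k = \<lfloor>log (real p) (w x ^ n)\<rfloor> + 1"
    have "log (real p) (w x ^ n) < of_int k"
      unfolding k_def by linarith
    then have 1: "w x ^ n < real p powr of_int k"
      using p pos by (simp add: log_less_iff)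
    have "of_int k \<le> log (real p) (w x ^ n) + 1"
      unfolding k_def by linarith
    also have "\<dots> = log (real p) (w x ^ n * real p)"
      using p pos by (simp add: log_mult)
    finally have "real p powr of_int k \<le> w x ^ n * real p"
      using p pos by (simp add: le_log_iff)
    also have "\<dots> < v x ^ n"
      using n pos by (simp add: power_divide field_simps)
    finally have 2: "real p powr of_int k < v x ^ n" .
    have powi: "real p powr of_int k = real p powi k"
      using p by (simp add: powr_real_of_int')
    have "(1 / real p) powi k = 1 / real p powi k"
      by (simp add: power_int_divide_distrib)
    then have "v (x ^ n * of_nat p powi k) > 1 \<and> w (x ^ n * of_nat p powi k) < 1"
      using 1 2 p by (simp add: v.mult w.mult v.power w.power v.power_int w.power_int val_p wp powi)
    then show ?thesis
      by blast
  qed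
qed

text \<open>In the induction \<open>a\<close> handles \<open>S\<close> and \<open>b\<close>
  separates v from the new place w. If w(a) = 1, high powers of a make b small on \<open>S\<close>
  without changing its value at w. If w(a) > 1 these powers would blow up at w; the factor a^n / (1
  + a^n) is used instead, which tends to 1 at v and w and to 0 on \<open>S\<close>.\<close>

lemma separate_places:
  fixes v :: "'a::field_char_0 \<Rightarrow> real"
  assumes "finite S" "S \<noteq> {}" "v \<in> places" "S \<subseteq> places" "v \<notin> S" "same_on_rats (insert v S)"
  shows "\<exists>a. v a > 1 \<and> (\<forall>w\<in>S. w a < 1)"
  using assms
proof (induction S rule: finite_ne_induct)
  case (singleton w)
  then show ?case
    using separate_two_places[of v w] by auto
next
  case (insert w S)
  interpret v: place v using insert.prems by (intro place_locale) auto
  interpret w: place w using insert.prems by (intro place_locale) auto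
  obtain a where a: "v a > 1" "\<And>w'. w' \<in> S \<Longrightarrow> w' a < 1"
    using insert.IH insert.prems same_on_rats_subset[OF insert.prems(4), of "insert v S"] by auto
  obtain b where b: "v b > 1" "w b < 1"
    using separate_two_places[of v w] insert.prems same_on_rats_subset[OF insert.prems(4), of "{v, w}"]
    by auto
  have place: "place w'" if "w' \<in> S" for w'
    using insert.prems that by (intro place_locale) auto
  consider "w a < 1" | "w a = 1" | "w a > 1"
    by linarith
  then show ?case
  proof cases
    case 1
    then show ?thesis
      using a by auto
  next
    case 2
    have "eventually (\<lambda>n. w' (a ^ n * b) < 1) sequentially" if "w' \<in> S" for w'
    proof -
      interpret w': place w' using place that .
      have "(\<lambda>n. w' a ^ n * w' b) \<longlonglongrightarrow> 0 * w' b"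
        using a(2)[OF that] by (intro tendsto_intros LIMSEQ_realpow_zero) auto
      then show ?thesis
        by (intro order_tendstoD(2)[of _ 0]) (simp_all add: w'.mult w'.power)
    qed
    then have "eventually (\<lambda>n. \<forall>w'\<in>S. w' (a ^ n * b) < 1) sequentially"
      using insert.hyps by (intro eventually_ball_finite) auto
    then obtain n where n: "\<forall>w'\<in>S. w' (a ^ n * b) < 1"
      unfolding eventually_sequentially by blast
    have "v (a ^ n * b) > 1"
      using a(1) b(1) one_le_power[of "v a" n] by (simp add: v.mult v.power less_1_mult' mult.commute)
    moreover have "w (a ^ n * b) < 1"
      using 2 b(2) by (simp add: w.mult w.power)
    ultimately show ?thesis
      using n by auto
  next
    case 3
    define t where "t n = a ^ n / (1 + a ^ n)" for n
    have lim: "(\<lambda>n. u (t n * b)) \<longlonglongrightarrow> u b" if "place u" "u a > 1" for u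
    proof -
      interpret u: place u by fact
      have "(\<lambda>n. u (t n - 1) * u b) \<longlonglongrightarrow> 0 * u b"
        unfolding t_def by (intro tendsto_intros u.frac_power_tendsto_1 that)
      moreover have "\<bar>u (t n * b) - u b\<bar> \<le> u (t n - 1) * u b" for n
        using u.abs_diff_le[of "t n * b" b] by (simp add: u.mult[symmetric] algebra_simps)
      ultimately have "(\<lambda>n. u (t n * b) - u b) \<longlonglongrightarrow> 0"
        by (intro Lim_null_comparison[of "\<lambda>n. u (t n * b) - u b" "\<lambda>n. u (t n - 1) * u b"]) auto
      then show ?thesis
        by (rule LIM_zero_cancel)
    qed
    have "eventually (\<lambda>n. w' (t n * b) < 1) sequentially" if "w' \<in> S" for w'
    proof -
      interpret w': place w' using place that .
      have "(\<lambda>n. w' (t n) * w' b) \<longlonglongrightarrow> 0 * w' b"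
        unfolding t_def by (intro tendsto_intros w'.frac_power_tendsto_0 a that)
      then show ?thesis
        by (intro order_tendstoD(2)[of _ 0]) (simp_all add: w'.mult)
    qed
    then have "eventually (\<lambda>n. \<forall>w'\<in>S. w' (t n * b) < 1) sequentially"
      using insert.hyps by (intro eventually_ball_finite) auto
    moreover have "eventually (\<lambda>n. v (t n * b) > 1) sequentially"
      using lim[OF v.place_axioms a(1)] b(1) by (rule order_tendstoD)
    moreover have "eventually (\<lambda>n. w (t n * b) < 1) sequentially"
      using lim[OF w.place_axioms 3] b(2) by (rule order_tendstoD)
    ultimately have "eventually (\<lambda>n. v (t n * b) > 1 \<and> (\<forall>w'\<in>insert w S. w' (t n * b) < 1)) sequentially"
      by eventually_elim auto
    then show ?thesis
      unfolding eventually_sequentially by blast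
  qed
qed

lemma weak_approximation:
  fixes v :: "'a::field_char_0 \<Rightarrow> real"
  assumes "finite S" "S \<subseteq> places" "same_on_rats S" "v \<in> S" "\<epsilon> > 0"
  shows "\<exists>\<theta>. v (1 - \<theta>) < \<epsilon> \<and> (\<forall>w\<in>S - {v}. w \<theta> < \<epsilon>)"
proof (cases "S = {v}")
  case True
  interpret v: place v using assms by (intro place_locale) auto
  show ?thesis
    using True assms(5) by (intro exI[of _ 1]) simp
next
  case False
  interpret v: place v using assms by (intro place_locale) auto
  have "\<exists>a. v a > 1 \<and> (\<forall>w\<in>S - {v}. w a < 1)"
  proof (rule separate_places)
    show "same_on_rats (insert v (S - {v}))"
      using assms(3,4) by (simp add: insert_absorb)
    show "S - {v} \<noteq> {}"
      using False assms(4) by auto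
  qed (use assms in auto)
  then obtain a where a: "v a > 1" "\<And>w. w \<in> S - {v} \<Longrightarrow> w a < 1"
    by blast
  have "eventually (\<lambda>n. w (a ^ n / (1 + a ^ n)) < \<epsilon>) sequentially" if "w \<in> S - {v}" for w
  proof -
    interpret w: place w using that assms by (intro place_locale) auto
    show ?thesis
      using w.frac_power_tendsto_0[OF a(2)[OF that]] assms(5) by (rule order_tendstoD)
  qed
  then have "eventually (\<lambda>n. \<forall>w\<in>S - {v}. w (a ^ n / (1 + a ^ n)) < \<epsilon>) sequentially"
    using assms(1) by (intro eventually_ball_finite) auto
  moreover have "eventually (\<lambda>n. v (1 - a ^ n / (1 + a ^ n)) < \<epsilon>) sequentially"
    using order_tendstoD(2)[OF v.frac_power_tendsto_1[OF a(1)] assms(5)]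
    by (simp add: v.minus_commute)
  ultimately have "eventually (\<lambda>n. v (1 - a ^ n / (1 + a ^ n)) < \<epsilon> \<and>
      (\<forall>w\<in>S - {v}. w (a ^ n / (1 + a ^ n)) < \<epsilon>)) sequentially"
    by eventually_elim auto
  then show ?thesis
    unfolding eventually_sequentially by blast
qed

subsection \<open>The sum of the local degrees\<close>

text \<open>Stated for indexed families because approximating elements with different indices may
  coincide; a coincidence gives a relation with coefficients 1 and -1.\<close>

lemma number_field_dependent:
  fixes a :: "'i \<Rightarrow> 'a::field_char_0"
  assumes nf: "number_field TYPE('a)" and fin: "finite I" and card: "card I > field_degree TYPE('a)"
  shows "\<exists>q. (\<exists>i\<in>I. q i \<noteq> 0) \<and> (\<Sum>i\<in>I. of_rat (q i) * a i) = 0"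
proof (cases "inj_on a I")
  case False
  then obtain i j where ij: "i \<in> I" "j \<in> I" "i \<noteq> j" "a i = a j"
    by (auto simp: inj_on_def)
  define q :: "'i \<Rightarrow> rat" where "q = (\<lambda>k. if k = i then 1 else if k = j then -1 else 0)"
  have "(\<Sum>k\<in>I. of_rat (q k) * a k) = (\<Sum>k\<in>{i, j}. of_rat (q k) * a k)"
    using ij fin by (intro sum.mono_neutral_right) (auto simp: q_def)
  also have "\<dots> = 0"
    using ij by (simp add: q_def)
  finally show ?thesis
    using ij(1) by (intro exI[of _ q]) (auto simp: q_def)
next
  case True
  obtain B :: "'a set" where B: "finite B" "rat_scale.span B = UNIV"
    using nf unfolding number_field_def by blast
  obtain C :: "'a set" where C: "rat_scale.independent C" "UNIV \<subseteq> rat_scale.span C"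
    "card C = field_degree TYPE('a)"
    using rat_scale.basis_exists[of UNIV] unfolding field_degree_def by metis
  have "finite C"
    using rat_scale.independent_span_bound[OF B(1) C(1)] B(2) by simp
  then have "\<not> rat_scale.independent (a ` I)"
    using rat_scale.independent_span_bound[of C "a ` I"] C card card_image[OF True] by fastforce
  then obtain u where u: "\<exists>x\<in>a ` I. u x \<noteq> 0" "(\<Sum>x\<in>a ` I. rat_scale (u x) x) = 0"
    using rat_scale.dependent_finite[of "a ` I"] fin by auto
  then show ?thesis
    by (intro exI[of _ "\<lambda>i. u (a i)"]) (auto simp: sum.reindex[OF True] rat_scale_def)
qed

text \<open>The \<open>e v i\<close> stand for approximations to independent elements at v, with the
  lower bound \<delta> v obtained from compactness. With too many pairs (v, i) the field elements
  \<open>\<theta> v * e v i\<close> satisfy a rational relation. Seen at the place v owning a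
  largest coefficient, it makes a combination of the \<open>e v i\<close> smaller than the lower
  bound allows.\<close>

lemma sum_le_field_degree:
  fixes S :: "('a::field_char_0 \<Rightarrow> real) set"
  assumes nf: "number_field TYPE('a)" and fin: "finite S" and places: "S \<subseteq> places"
    and same: "same_on_rats S"
    and pos: "\<And>v. v \<in> S \<Longrightarrow> \<delta> v > 0"
    and bound: "\<And>v q i. v \<in> S \<Longrightarrow> i < m v \<Longrightarrow>
           \<delta> v * v (of_rat (q i)) \<le> v (\<Sum>i<m v. of_rat (q i) * e v i)"
  shows "(\<Sum>v\<in>S. m v) \<le> field_degree TYPE('a)"
proof (rule ccontr)
  assume contr: "\<not> ?thesis"
  define I where "I = (SIGMA v:S. {..<m v})"
  have finI: "finite I"
    using fin by (simp add: I_def)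
  have card: "card I > field_degree TYPE('a)"
    using contr fin by (simp add: I_def)
  have "S \<noteq> {}"
    using contr by auto
  \<comment> \<open>One constant that bounds the total size of all \<open>e w i\<close> at each
    place of \<open>S\<close>. Dividing by E + 1 below gives \<epsilon> * E < \<delta> v strictly,
    also when E = 0.\<close>
  define E where "E = (\<Sum>v\<in>S. \<Sum>(w, i)\<in>I. v (e w i))"
  have nonneg: "v x \<ge> 0" if "v \<in> S" for v x
    using abs_val.nonneg[OF place.axioms(1)[OF place_locale]] that places by blast
  have E0: "E \<ge> 0"
    unfolding E_def by (intro sum_nonneg) (auto simp: nonneg)
  define \<epsilon> where "\<epsilon> = Min (\<delta> ` S) / (E + 1)"
  have Min_pos: "Min (\<delta> ` S) > 0"
    using fin \<open>S \<noteq> {}\<close> pos by simp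
  have "\<epsilon> > 0"
    using Min_pos E0 by (simp add: \<epsilon>_def)
  have small: "\<epsilon> * E < \<delta> v" if "v \<in> S" for v
  proof -
    have "\<epsilon> * E < Min (\<delta> ` S)"
      using Min_pos E0 by (simp add: \<epsilon>_def field_simps)
    also have "\<dots> \<le> \<delta> v"
      using fin that by simp
    finally show ?thesis .
  qed
  have "\<exists>\<theta>. v (1 - \<theta>) < \<epsilon> \<and> (\<forall>w\<in>S - {v}. w \<theta> < \<epsilon>)" if "v \<in> S" for v
    using weak_approximation[OF fin places same that \<open>\<epsilon> > 0\<close>] .
  then obtain \<theta> where \<theta>: "\<And>v. v \<in> S \<Longrightarrow> v (1 - \<theta> v) < \<epsilon>"
    "\<And>v w. v \<in> S \<Longrightarrow> w \<in> S - {v} \<Longrightarrow> w (\<theta> v) < \<epsilon>"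
    by metis
  obtain q where q: "\<exists>k\<in>I. q k \<noteq> 0"
    and rel: "(\<Sum>k\<in>I. of_rat (q k) * (\<theta> (fst k) * e (fst k) (snd k))) = 0"
    using number_field_dependent[OF nf finI card, of "\<lambda>k. \<theta> (fst k) * e (fst k) (snd k)"] by blast
  \<comment> \<open>Coefficients are compared at an arbitrary place u of \<open>S\<close>; the
    places agree on rationals, so the maximum found is also one at the place v that belongs to
    it.\<close>
  obtain u where "u \<in> S"
    using \<open>S \<noteq> {}\<close> by blast
  have "I \<noteq> {}"
    using q by auto
  then obtain k where k: "k \<in> I" and max: "\<And>l. l \<in> I \<Longrightarrow> u (of_rat (q l)) \<le> u (of_rat (q k))"
    using finite_ex_maximum[OF finI, of "\<lambda>k. u (of_rat (q k))"] by blast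
  obtain v i where vi: "k = (v, i)" "v \<in> S" "i < m v"
    using k by (auto simp: I_def)
  interpret v: place v using vi places by (intro place_locale) auto
  have uv: "u (of_rat r) = v (of_rat r)" for r
    using same_on_ratsD[OF same \<open>u \<in> S\<close> \<open>v \<in> S\<close>] .
  define Q where "Q = v (of_rat (q k))"
  have le_Q: "v (of_rat (q l)) \<le> Q" if "l \<in> I" for l
    using max[OF that] by (simp add: uv Q_def)
  have "Q > 0"
  proof -
    obtain l where "l \<in> I" "q l \<noteq> 0"
      using q by blast
    then have "v (of_rat (q l)) > 0"
      by simp
    then show ?thesis
      using le_Q[OF \<open>l \<in> I\<close>] by linarith
  qed
  \<comment> \<open>Subtracting the vanishing relation rewrites the part belonging to v as a sum
    over all pairs, in which each term carries the factor 1 - \<theta> v or - \<theta> w. Both are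
    smaller than \<epsilon> at v.\<close>
  have "(\<Sum>i<m v. of_rat (q (v, i)) * e v i) =
      (\<Sum>w\<in>S. if w = v then \<Sum>i<m w. of_rat (q (w, i)) * e w i else 0)"
    using fin vi by simp
  also have "\<dots> = (\<Sum>w\<in>S. \<Sum>i<m w. (if w = v then 1 else 0) * (of_rat (q (w, i)) * e w i))"
    by (intro sum.cong) auto
  also have "\<dots> = (\<Sum>(w, i)\<in>I. (if w = v then 1 else 0) * (of_rat (q (w, i)) * e w i))"
    unfolding I_def using fin by (subst sum.Sigma) auto
  also have "\<dots> = (\<Sum>(w, i)\<in>I. (if w = v then 1 else 0) * (of_rat (q (w, i)) * e w i)) -
      (\<Sum>k\<in>I. of_rat (q k) * (\<theta> (fst k) * e (fst k) (snd k)))"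
    by (simp add: rel)
  also have "\<dots> = (\<Sum>(w, i)\<in>I. of_rat (q (w, i)) * (((if w = v then 1 else 0) - \<theta> w) * e w i))"
    unfolding sum_subtractf[symmetric] by (intro sum.cong) (auto simp: algebra_simps)
  finally have "v (\<Sum>i<m v. of_rat (q (v, i)) * e v i) \<le>
      (\<Sum>k\<in>I. v (case k of (w, i) \<Rightarrow> of_rat (q (w, i)) * (((if w = v then 1 else 0) - \<theta> w) * e w i)))"
    using v.sum_le by simp
  also have "\<dots> \<le> (\<Sum>(w, i)\<in>I. Q * (\<epsilon> * v (e w i)))"
  proof (intro sum_mono, clarify)
    fix w i
    assume wi: "(w, i) \<in> I"
    then have "w \<in> S"
      by (simp add: I_def)
    have "v ((if w = v then 1 else 0) - \<theta> w) \<le> \<epsilon>"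
      using \<theta>(1)[OF \<open>v \<in> S\<close>] \<theta>(2)[OF \<open>w \<in> S\<close>, of v] \<open>v \<in> S\<close> by auto
    then show "v (of_rat (q (w, i)) * (((if w = v then 1 else 0) - \<theta> w) * e w i)) \<le> Q * (\<epsilon> * v (e w i))"
      unfolding v.mult using le_Q[OF wi] \<open>\<epsilon> > 0\<close> \<open>Q > 0\<close> by (intro mult_mono) auto
  qed
  also have "\<dots> = Q * (\<epsilon> * (\<Sum>(w, i)\<in>I. v (e w i)))"
    by (simp add: sum_distrib_left case_prod_unfold)
  also have "\<dots> \<le> Q * (\<epsilon> * E)"
    unfolding E_def using vi fin \<open>Q > 0\<close> \<open>\<epsilon> > 0\<close>
    by (intro mult_left_mono member_le_sum[of v S "\<lambda>v. \<Sum>(w, i)\<in>I. v (e w i)"])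
      (auto intro!: sum_nonneg simp: nonneg)
  also have "\<dots> < Q * \<delta> v"
    using small vi \<open>Q > 0\<close> by simp
  also have "\<dots> = \<delta> v * v (of_rat (q (v, i)))"
    by (simp add: Q_def vi)
  also have "\<dots> \<le> v (\<Sum>i<m v. of_rat (q (v, i)) * e v i)"
    using bound[OF vi(2,3), of "\<lambda>i. q (v, i)"] .
  finally show False
    by simp
qed

text \<open>Lengths of families appear in place of local degrees, because the case of one place is
  what shows that the local degree is such a length.\<close>

lemma sum_length_independent_le:
  fixes S :: "('a::field_char_0 \<Rightarrow> real) set"
  assumes nf: "number_field TYPE('a)" and fin: "finite S" and places: "S \<subseteq> places"
    and same: "same_on_rats S"
    and indep: "\<And>v. v \<in> S \<Longrightarrow> ring.independent (completion v) (rat_completion v) (Us v)"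
  shows "(\<Sum>v\<in>S. length (Us v)) \<le> field_degree TYPE('a)"
proof -
  have "\<exists>e \<delta>. \<delta> > 0 \<and> (\<forall>q. \<forall>i<length (Us v). \<delta> * v (of_rat (q i)) \<le>
          v (\<Sum>i<length (Us v). of_rat (q i) * e i))" if vS: "v \<in> S" for v
  proof -
    interpret place v using vS places by (intro place_locale) auto
    show ?thesis
    proof (rule independent_cauchy_seqs[OF indep[OF vS]], goal_cases)
      case (1 s)
      show ?case
        by (rule independent_lower_bound[OF 1])
    qed
  qed
  then obtain e \<delta> where "\<And>v. v \<in> S \<Longrightarrow> \<delta> v > 0" "\<And>v q i. v \<in> S \<Longrightarrow> i < length (Us v) \<Longrightarrow>
      \<delta> v * v (of_rat (q i)) \<le> v (\<Sum>i<length (Us v). of_rat (q i) * e v i)"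
    by metis
  then show ?thesis
    by (rule sum_le_field_degree[OF nf fin places same])
qed

lemma sum_local_degree_le:
  fixes S :: "('a::field_char_0 \<Rightarrow> real) set"
  assumes nf: "number_field TYPE('a)" and fin: "finite S" and places: "S \<subseteq> places"
    and same: "same_on_rats S"
  shows "(\<Sum>v\<in>S. local_degree v) \<le> field_degree TYPE('a)"
proof -
  have "\<exists>Us. ring.independent (completion v) (rat_completion v) Us \<and> length Us = local_degree v"
    if "v \<in> S" for v
  proof -
    interpret place v using that places by (intro place_locale) auto
    have "length Us \<le> field_degree TYPE('a)" if "Q.independent (rat_completion v) Us" for Us
      using sum_length_independent_le[OF nf, of "{v}" "\<lambda>_. Us"] that place
      by (simp add: same_on_rats_def)
    then show ?thesis
      by (rule local_degree_eq_length_independent) auto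
  qed
  then obtain Us where "\<And>v. v \<in> S \<Longrightarrow> ring.independent (completion v) (rat_completion v) (Us v)"
    and len: "\<And>v. v \<in> S \<Longrightarrow> length (Us v) = local_degree v"
    by metis
  then show ?thesis
    using sum_length_independent_le[OF nf fin places same, of Us] by simp
qed

section \<open>Local bounds by interpolation\<close>

lemma lagrange_interpolation:
  fixes F :: "'a::field_char_0 poly" and x :: "nat \<Rightarrow> 'a"
  assumes fin: "finite J" and inj: "inj_on x J" and deg: "degree F < card J"
  shows "F = (\<Sum>i\<in>J. Polynomial.smult (poly F (x i) / (\<Prod>j\<in>J - {i}. x i - x j)) (\<Prod>j\<in>J - {i}. [:- x j, 1:]))"
    (is "F = ?G")
proof (rule poly_eqI_degree)
  show "card (x ` J) > degree F"
    using deg card_image[OF inj] by simp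
  have "degree ?G \<le> card J - 1"
  proof (rule degree_sum_le[OF fin])
    fix i
    assume "i \<in> J"
    have "degree (\<Prod>j\<in>J - {i}. [:- x j, 1:]) \<le> (\<Sum>j\<in>J - {i}. degree [:- x j, 1:])"
      using degree_prod_sum_le[of "J - {i}" "\<lambda>j. [:- x j, 1:]"] fin by (simp add: o_def)
    also have "\<dots> = card J - 1"
      using \<open>i \<in> J\<close> by simp
    finally show "degree (Polynomial.smult (poly F (x i) / (\<Prod>j\<in>J - {i}. x i - x j)) (\<Prod>j\<in>J - {i}. [:- x j, 1:]))
        \<le> card J - 1"
      using degree_smult_le order_trans by blast
  qed
  then show "card (x ` J) > degree ?G"
    using deg card_image[OF inj] by simp
  fix y
  assume "y \<in> x ` J"
  then obtain k where k: "k \<in> J" "y = x k"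
    by blast
  have "poly ?G y = (\<Sum>i\<in>J. if i = k then poly F (x k) else 0)"
    unfolding poly_sum
  proof (rule sum.cong[OF refl])
    fix i
    assume i: "i \<in> J"
    show "poly (Polynomial.smult (poly F (x i) / (\<Prod>j\<in>J - {i}. x i - x j)) (\<Prod>j\<in>J - {i}. [:- x j, 1:])) y =
        (if i = k then poly F (x k) else 0)"
    proof (cases "i = k")
      case True
      have "(\<Prod>j\<in>J - {k}. x k - x j) \<noteq> 0"
        using fin inj k by (auto simp: inj_on_def)
      then show ?thesis
        using True k by (simp add: poly_prod)
    next
      case False
      then have "(\<Prod>j\<in>J - {i}. y - x j) = 0"
        using fin k by auto
      then show ?thesis
        using False by (simp add: poly_prod)
    qed
  qed
  also have "\<dots> = poly F y"
    using fin k by simp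
  finally show "poly F y = poly ?G y"
    by simp
qed

section \<open>Denominators and numerators of the interpolation formula\<close>

lemma prod_dvd_fact:
  fixes T :: "int set"
  assumes "T \<subseteq> {1..int n}"
  shows "\<Prod>T dvd fact n"
proof -
  have "\<Prod>T dvd \<Prod>{1..int n}"
    using assms by (intro prod_dvd_prod_subset) auto
  also have "\<Prod>{1..int n} = (\<Prod>i\<in>{1..n}. int i)"
    by (rule prod.reindex_bij_witness[of _ int nat]) auto
  also have "\<dots> = fact n"
    by (simp add: fact_prod)
  finally show ?thesis .
qed

text \<open>The differences to smaller nodes are distinct integers between 1 and x i - A, those to
  larger nodes are, up to sign, distinct integers between 1 and B - x i. The product of the two
  factorials divides (B - A)! with a binomial coefficient as quotient.\<close>

lemma prod_differences_dvd_fact: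
  fixes x :: "nat \<Rightarrow> int"
  assumes fin: "finite J" and inj: "inj_on x J" and range: "x ` J \<subseteq> {A..B}" and i: "i \<in> J"
  shows "(\<Prod>j\<in>J - {i}. x i - x j) dvd fact (nat (B - A))"
proof -
  define L where "L = {j \<in> J. x j < x i}"
  define U where "U = {j \<in> J. x j > x i}"
  have xi: "A \<le> x i" "x i \<le> B"
    using range i by auto
  have split: "J - {i} = L \<union> U"
    using inj i by (force simp: L_def U_def inj_on_def)
  have "(\<Prod>j\<in>J - {i}. x i - x j) = (\<Prod>j\<in>L. x i - x j) * (\<Prod>j\<in>U. x i - x j)"
    unfolding split using fin by (intro prod.union_disjoint) (auto simp: L_def U_def)
  also have "\<dots> dvd fact (nat (x i - A)) * fact (nat (B - x i))"
  proof (rule mult_dvd_mono)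
    have "(\<Prod>j\<in>L. x i - x j) = \<Prod>((\<lambda>j. x i - x j) ` L)"
      using inj by (subst prod.reindex) (auto simp: inj_on_def L_def)
    also have "\<dots> dvd fact (nat (x i - A))"
      using range xi by (intro prod_dvd_fact) (force simp: L_def)
    finally show "(\<Prod>j\<in>L. x i - x j) dvd fact (nat (x i - A))" .
    have "(\<Prod>j\<in>U. x i - x j) = (\<Prod>j\<in>U. (-1) * (x j - x i))"
      by simp
    also have "\<dots> = (-1) ^ card U * (\<Prod>j\<in>U. x j - x i)"
      by (simp only: prod.distrib prod_constant)
    also have "\<dots> dvd (\<Prod>j\<in>U. x j - x i)"
      by (cases "even (card U)") simp_all
    also have "(\<Prod>j\<in>U. x j - x i) = \<Prod>((\<lambda>j. x j - x i) ` U)"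
      using inj by (subst prod.reindex) (auto simp: inj_on_def U_def)
    also have "\<dots> dvd fact (nat (B - x i))"
      using range xi by (intro prod_dvd_fact) (force simp: U_def)
    finally show "(\<Prod>j\<in>U. x i - x j) dvd fact (nat (B - x i))" .
  qed
  also have "\<dots> dvd fact (nat (x i - A) + nat (B - x i))"
    by (rule fact_fact_dvd_fact)
  also have "nat (x i - A) + nat (B - x i) = nat (B - A)"
    using xi by (simp add: nat_add_distrib[symmetric])
  finally show ?thesis .
qed

text \<open>A coefficient of (X - y) P is one coefficient of P minus y times another, so each factor
  raises a common bound by at most 1 + M.\<close>

lemma (in abs_val) coeff_prod_linear_le:
  assumes "finite J" "\<And>j. j \<in> J \<Longrightarrow> v (y j) \<le> M"
  shows "v (poly.coeff (\<Prod>j\<in>J. [:- y j, 1:]) k) \<le> (1 + M) ^ card J"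
  using assms
proof (induction J arbitrary: k rule: finite_induct)
  case empty
  then show ?case
    by (cases k) auto
next
  case (insert j J)
  let ?P = "\<Prod>j\<in>J. [:- y j, 1:]"
  have "v (y j) \<le> M"
    using insert.prems by simp
  then have M: "v (y j) \<le> M" "0 \<le> M"
    using nonneg[of "y j"] by linarith+
  have IH: "v (poly.coeff ?P k) \<le> (1 + M) ^ card J" for k
    using insert by auto
  have "v (poly.coeff ([:- y j, 1:] * ?P) k) \<le> M * (1 + M) ^ card J + (1 + M) ^ card J"
  proof (cases k)
    case 0
    have "v (y j) * v (poly.coeff ?P 0) \<le> M * (1 + M) ^ card J"
      using IH M by (intro mult_mono) auto
    then show ?thesis
      using 0 M by (simp add: mult add_increasing2)
  next
    case (Suc l)
    have "v (y j) * v (poly.coeff ?P k) \<le> M * (1 + M) ^ card J"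
      using IH M by (intro mult_mono) auto
    then show ?thesis
      using Suc IH[of l] triangle_diff[of "poly.coeff ?P l" "y j * poly.coeff ?P k"] by (simp add: mult)
  qed
  then show ?case
    using insert.hyps by (simp add: algebra_simps)
qed

lemma (in nonarch_abs_val) coeff_prod_linear_le_1:
  assumes "finite J" "\<And>j. j \<in> J \<Longrightarrow> v (y j) \<le> 1"
  shows "v (poly.coeff (\<Prod>j\<in>J. [:- y j, 1:]) k) \<le> 1"
  using assms
proof (induction J arbitrary: k rule: finite_induct)
  case empty
  then show ?case
    by (cases k) auto
next
  case (insert j J)
  let ?P = "\<Prod>j\<in>J. [:- y j, 1:]"
  have IH: "v (poly.coeff ?P k) \<le> 1" for k
    using insert by auto
  have y: "v (y j * poly.coeff ?P k) \<le> 1" for k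
    using IH insert.prems by (simp add: mult mult_le_one)
  have "v (poly.coeff ([:- y j, 1:] * ?P) k) \<le> 1"
  proof (cases k)
    case 0
    then show ?thesis
      using y by simp
  next
    case (Suc l)
    then show ?thesis
      using y[of k] IH[of l] ultrametric[of "poly.coeff ?P l" "- (y j * poly.coeff ?P k)"] by simp
  qed
  then show ?case
    using insert.hyps by simp
qed

section \<open>Interpolation bounds at a single place\<close>

lemma poly_abs_le_iff: "poly_abs v P \<le> c \<longleftrightarrow> (\<forall>k\<le>degree P. v (poly.coeff P k) \<le> c)"
  unfolding poly_abs_def by (subst Max_le_iff) auto

lemma poly_abs_coeff_le: "k \<le> degree P \<Longrightarrow> v (poly.coeff P k) \<le> poly_abs v P"
  using poly_abs_le_iff[of v P "poly_abs v P"] by simp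

text \<open>The denominators are nonzero integers and only decrease the terms. Each of the d + 1
  Lagrange terms has coefficients of size at most T (1 + M)^d, and M \<ge> 1 allows 1 + M to be
  replaced by 2M.\<close>

lemma (in place) arch_poly_abs_le:
  fixes F :: "'a poly" and x :: "nat \<Rightarrow> int"
  assumes "\<not> nonarchimedean v" "finite J" "inj_on x J" "degree F \<le> d" "card J = d + 1"
    and M: "\<And>j. j \<in> J \<Longrightarrow> \<bar>x j\<bar> \<le> M" "M \<ge> 1"
    and T: "\<And>j. j \<in> J \<Longrightarrow> v (poly F (of_int (x j))) \<le> T" "T \<ge> 0"
  shows "poly_abs v F \<le> (real d + 1) * (2 * of_int M) ^ d * T"
  unfolding poly_abs_le_iff
proof (intro allI impI)
  fix k
  assume "k \<le> degree F"
  define y where "y j = (of_int (x j) :: 'a)" for j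
  have y: "inj_on y J"
    using assms(3) by (auto simp: inj_on_def y_def)
  have "poly.coeff F k = poly.coeff (\<Sum>i\<in>J. Polynomial.smult (poly F (y i) / (\<Prod>j\<in>J - {i}. y i - y j))
      (\<Prod>j\<in>J - {i}. [:- y j, 1:])) k"
    using lagrange_interpolation[OF assms(2) y, of F] assms(4,5) by simp
  also have "\<dots> = (\<Sum>i\<in>J. poly F (y i) / (\<Prod>j\<in>J - {i}. y i - y j) * poly.coeff (\<Prod>j\<in>J - {i}. [:- y j, 1:]) k)"
    by (simp add: coeff_sum)
  finally have "v (poly.coeff F k) \<le>
      (\<Sum>i\<in>J. v (poly F (y i) / (\<Prod>j\<in>J - {i}. y i - y j) * poly.coeff (\<Prod>j\<in>J - {i}. [:- y j, 1:]) k))"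
    using sum_le by simp
  also have "\<dots> \<le> (\<Sum>i\<in>J. T * (2 * of_int M) ^ d)"
  proof (rule sum_mono)
    fix i
    assume i: "i \<in> J"
    define p where "p = (\<Prod>j\<in>J - {i}. x i - x j)"
    have p: "(\<Prod>j\<in>J - {i}. y i - y j) = of_int p"
      by (simp add: p_def y_def)
    have "p \<noteq> 0"
      using assms(2,3) i by (auto simp: p_def inj_on_def)
    then have p1: "v (of_int p) \<ge> 1"
      unfolding arch_of_int[OF assms(1)] by linarith
    have "v (poly F (y i)) / v (of_int p) \<le> v (poly F (y i)) / 1"
      using p1 by (intro divide_left_mono) auto
    also have "\<dots> \<le> T"
      using T i by (simp add: y_def)
    finally have 1: "v (poly F (y i) / (\<Prod>j\<in>J - {i}. y i - y j)) \<le> T"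
      by (simp add: divide p)
    have "v (y j) \<le> of_int M" if "j \<in> J" for j
      unfolding y_def arch_of_int[OF assms(1)] using M(1)[OF that] by linarith
    then have "v (poly.coeff (\<Prod>j\<in>J - {i}. [:- y j, 1:]) k) \<le> (1 + of_int M) ^ card (J - {i})"
      using assms(2) by (intro coeff_prod_linear_le) auto
    also have "card (J - {i}) = d"
      using i assms(5) by simp
    also have "(1 + of_int M) ^ d \<le> (2 * of_int M :: real) ^ d"
      using M(2) by (intro power_mono) auto
    finally have "v (poly.coeff (\<Prod>j\<in>J - {i}. [:- y j, 1:]) k) \<le> (2 * of_int M) ^ d" .
    with 1 show "v (poly F (y i) / (\<Prod>j\<in>J - {i}. y i - y j) * poly.coeff (\<Prod>j\<in>J - {i}. [:- y j, 1:]) k)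
        \<le> T * (2 * of_int M) ^ d"
      unfolding mult using T(2) by (intro mult_mono) auto
  qed
  also have "\<dots> = (real d + 1) * (2 * of_int M) ^ d * T"
    using assms(5) by simp
  finally show "v (poly.coeff F k) \<le> (real d + 1) * (2 * of_int M) ^ d * T" .
qed

text \<open>The numerator polynomials have integral coefficients and the ultrametric inequality
  absorbs the sum. The constant comes from the denominators: a divisor of (B - A)! is at least as
  large as (B - A)! in absolute value.\<close>

lemma (in nonarch_abs_val) nonarch_poly_abs_le:
  fixes F :: "'a poly" and x :: "nat \<Rightarrow> int"
  assumes "finite J" "inj_on x J" "degree F < card J" "x ` J \<subseteq> {A..B}"
    and T: "\<And>j. j \<in> J \<Longrightarrow> v (poly F (of_int (x j))) \<le> T" "T \<ge> 0"
  shows "poly_abs v F \<le> v (1 / fact (nat (B - A))) * T"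
  unfolding poly_abs_le_iff
proof (intro allI impI)
  fix k
  assume "k \<le> degree F"
  define y where "y j = (of_int (x j) :: 'a)" for j
  have y: "inj_on y J"
    using assms(2) by (auto simp: inj_on_def y_def)
  have "poly.coeff F k = poly.coeff (\<Sum>i\<in>J. Polynomial.smult (poly F (y i) / (\<Prod>j\<in>J - {i}. y i - y j))
      (\<Prod>j\<in>J - {i}. [:- y j, 1:])) k"
    using lagrange_interpolation[OF assms(1) y assms(3)] by simp
  also have "\<dots> = (\<Sum>i\<in>J. poly F (y i) / (\<Prod>j\<in>J - {i}. y i - y j) * poly.coeff (\<Prod>j\<in>J - {i}. [:- y j, 1:]) k)"
    by (simp add: coeff_sum)
  also have "v \<dots> \<le> v (1 / fact (nat (B - A))) * T"
  proof (rule sum_le_bound)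
    fix i
    assume i: "i \<in> J"
    define p where "p = (\<Prod>j\<in>J - {i}. x i - x j)"
    have p: "(\<Prod>j\<in>J - {i}. y i - y j) = of_int p"
      by (simp add: p_def y_def)
    have "p dvd fact (nat (B - A))"
      unfolding p_def by (rule prod_differences_dvd_fact[OF assms(1,2,4) i])
    then have "v (of_int (fact (nat (B - A)))) \<le> v (of_int p)"
      by (rule of_int_dvd_le)
    then have le: "v (fact (nat (B - A))) \<le> v (of_int p)"
      by simp
    have pos: "v (fact (nat (B - A))) > 0"
      by simp
    have "v (poly F (y i)) / v (of_int p) \<le> v (poly F (y i)) / v (fact (nat (B - A)))"
      using le pos by (intro divide_left_mono mult_pos_pos) (simp, simp, linarith, linarith)
    also have "\<dots> \<le> T / v (fact (nat (B - A)))"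
      using T i by (intro divide_right_mono) (auto simp: y_def)
    finally have 1: "v (poly F (y i) / (\<Prod>j\<in>J - {i}. y i - y j)) \<le> v (1 / fact (nat (B - A))) * T"
      by (simp add: divide p)
    have "v (poly.coeff (\<Prod>j\<in>J - {i}. [:- y j, 1:]) k) \<le> 1"
      using assms(1) by (intro coeff_prod_linear_le_1) (auto simp: y_def of_int_le_1)
    with 1 have "v (poly F (y i) / (\<Prod>j\<in>J - {i}. y i - y j)) *
        v (poly.coeff (\<Prod>j\<in>J - {i}. [:- y j, 1:]) k) \<le> v (1 / fact (nat (B - A))) * T * 1"
      using T(2) by (intro mult_mono) auto
    then show "v (poly F (y i) / (\<Prod>j\<in>J - {i}. y i - y j) * poly.coeff (\<Prod>j\<in>J - {i}. [:- y j, 1:]) k)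
        \<le> v (1 / fact (nat (B - A))) * T"
      by (simp only: mult mult_1_right)
  qed (use T in auto)
  finally show "v (poly.coeff F k) \<le> v (1 / fact (nat (B - A))) * T" .
qed

text \<open>\<open>m\<close> is a (d + 1)-st smallest index: \<open>J\<close> consists of d smallest
  ones and a minimum \<open>m\<close> of the remaining N - d. Each of those N - d indices,
  \<open>m\<close> included, satisfies g m \<le> g i.\<close>

lemma exists_small_values:
  fixes g :: "nat \<Rightarrow> real"
  assumes "d < N"
  shows "\<exists>J\<subseteq>{1..N}. \<exists>m\<in>J. card J = d + 1 \<and> (\<forall>j\<in>J. g j \<le> g m) \<and>
    card {i \<in> {1..N}. g m \<le> g i} \<ge> N - d"
proof -
  have "\<exists>J\<subseteq>{1..N}. card J = k \<and> (\<forall>j\<in>J. \<forall>i\<in>{1..N} - J. g j \<le> g i)" if "k \<le> N" for k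
    using that
  proof (induction k)
    case 0
    show ?case
      by (intro exI[of _ "{}"]) auto
  next
    case (Suc k)
    then obtain J where J: "J \<subseteq> {1..N}" "card J = k" "\<forall>j\<in>J. \<forall>i\<in>{1..N} - J. g j \<le> g i"
      by auto
    have "finite J"
      using J(1) finite_subset by blast
    have "{1..N} - J \<noteq> {}"
    proof
      assume "{1..N} - J = {}"
      then have "J = {1..N}"
        using J(1) by blast
      then show False
        using J(2) Suc.prems by simp
    qed
    then obtain m where m: "m \<in> {1..N} - J" "\<And>i. i \<in> {1..N} - J \<Longrightarrow> g m \<le> g i"
      using ex_is_arg_min_if_finite[of "{1..N} - J" g] by (auto simp: is_arg_min_linorder)
    then show ?case
      using J \<open>finite J\<close> by (intro exI[of _ "insert m J"]) auto
  qed
  from this[of d] obtain J where J: "J \<subseteq> {1..N}" "card J = d" "\<forall>j\<in>J. \<forall>i\<in>{1..N} - J. g j \<le> g i"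
    using assms by auto
  have fin: "finite J"
    using J(1) finite_subset by blast
  have cardJ: "card ({1..N} - J) = N - d"
    using J fin by (simp add: card_Diff_subset)
  then have "{1..N} - J \<noteq> {}"
    using assms by (metis card.empty less_numeral_extra(3) zero_less_diff)
  then obtain m where m: "m \<in> {1..N} - J" "\<And>i. i \<in> {1..N} - J \<Longrightarrow> g m \<le> g i"
    using ex_is_arg_min_if_finite[of "{1..N} - J" g] by (auto simp: is_arg_min_linorder)
  have "N - d \<le> card {i \<in> {1..N}. g m \<le> g i}"
    unfolding cardJ[symmetric] using m by (intro card_mono) auto
  then show ?thesis
    using m J fin by (intro exI[of _ "insert m J"] conjI bexI[of _ m]) auto
qed

text \<open>
  Interpolate at the d + 1 points where F is smallest: at each of the remaining N - d - 1 points,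
  and at the worst interpolation point, F is at least as large as the interpolation data.
\<close>

lemma ln_max_le_average:
  fixes g :: "nat \<Rightarrow> real"
  assumes "d < N" "c \<ge> 1"
    and bound: "\<And>J T. J \<subseteq> {1..N} \<Longrightarrow> card J = d + 1 \<Longrightarrow> (\<And>j. j \<in> J \<Longrightarrow> g j \<le> T) \<Longrightarrow> T \<ge> 0 \<Longrightarrow> a \<le> c * T"
  shows "ln (max 1 a) \<le> ln c + 1 / (real N - real d) * (\<Sum>i=1..N. ln (max 1 (g i)))"
proof -
  obtain J m where J: "J \<subseteq> {1..N}" "m \<in> J" "card J = d + 1" "\<forall>j\<in>J. g j \<le> g m"
    and card: "card {i \<in> {1..N}. g m \<le> g i} \<ge> N - d"
    using exists_small_values[OF assms(1), of g] by blast
  \<comment> \<open>Truncation at 1 makes ln t nonnegative, and t is still an admissible T for the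
    set \<open>J\<close>.\<close>
  define t where "t = max 1 (g m)"
  have "a \<le> c * t"
    using J by (intro bound) (auto simp: t_def le_max_iff_disj)
  moreover have "1 * 1 \<le> c * t"
    using assms(2) by (intro mult_mono) (auto simp: t_def)
  ultimately have "ln (max 1 a) \<le> ln (c * t)"
    by (subst ln_le_cancel_iff) auto
  also have "\<dots> = ln c + ln t"
    using assms(2) by (subst ln_mult) (auto simp: t_def)
  also have "ln t \<le> 1 / (real N - real d) * (\<Sum>i=1..N. ln (max 1 (g i)))"
  proof -
    \<comment> \<open>At least N - d indices contribute ln t or more, and the others a nonnegative
      amount.\<close>
    have "(real N - real d) * ln t \<le> real (card {i \<in> {1..N}. g m \<le> g i}) * ln t"
      using card assms(1) by (intro mult_right_mono) (auto simp: t_def)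
    also have "\<dots> = (\<Sum>i\<in>{i \<in> {1..N}. g m \<le> g i}. ln t)"
      by simp
    also have "\<dots> \<le> (\<Sum>i\<in>{i \<in> {1..N}. g m \<le> g i}. ln (max 1 (g i)))"
      by (intro sum_mono) (auto simp: t_def)
    also have "\<dots> \<le> (\<Sum>i=1..N. ln (max 1 (g i)))"
      by (intro sum_mono2) auto
    finally show ?thesis
      using assms(1) by (simp add: field_simps)
  qed
  finally show ?thesis
    by simp
qed

lemma (in place) local_height_bound:
  fixes F :: "'a poly" and x :: "nat \<Rightarrow> int"
  assumes "degree F \<le> d" "d < N" "inj_on x {1..N}" "x ` {1..N} \<subseteq> {A..B}"
    and M: "\<And>i. i \<in> {1..N} \<Longrightarrow> \<bar>x i\<bar> \<le> M" "M \<ge> 1"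
  shows "ln (max 1 (poly_abs v F))
    \<le> (if nonarchimedean v then ln (v (1 / fact (nat (B - A))))
       else real d * ln (2 * real_of_int M) + ln (real d + 1))
      + 1 / (real N - real d) * (\<Sum>i=1..N. ln (max 1 (v (poly F (of_int (x i))))))"
proof (cases "nonarchimedean v")
  case True
  then interpret nonarch_abs_val v
    by unfold_locales
  have "v (fact (nat (B - A))) \<le> 1"
    using of_int_le_1[of "fact (nat (B - A))"] by simp
  moreover have "v (fact (nat (B - A))) > 0"
    by simp
  ultimately have c: "v (1 / fact (nat (B - A))) \<ge> 1"
    by (simp add: divide)
  have "ln (max 1 (poly_abs v F)) \<le> ln (v (1 / fact (nat (B - A))))
      + 1 / (real N - real d) * (\<Sum>i=1..N. ln (max 1 (v (poly F (of_int (x i))))))"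
  proof (rule ln_max_le_average[OF assms(2) c])
    fix J T
    assume J: "J \<subseteq> {1..N}" "card J = d + 1" "\<And>j. j \<in> J \<Longrightarrow> v (poly F (of_int (x j))) \<le> T" "T \<ge> (0::real)"
    then show "poly_abs v F \<le> v (1 / fact (nat (B - A))) * T"
      using assms finite_subset[OF J(1)] inj_on_subset[OF assms(3) J(1)]
      by (intro nonarch_poly_abs_le[OF _ _ _ _ J(3,4)]) auto
  qed
  then show ?thesis
    using True by simp
next
  case False
  have c: "(real d + 1) * (2 * real_of_int M) ^ d \<ge> 1"
  proof -
    have "1 \<le> (2 * real_of_int M) ^ d"
      using M(2) by (intro one_le_power) simp
    then have "1 * 1 \<le> (real d + 1) * (2 * real_of_int M) ^ d"
      by (intro mult_mono) auto
    then show ?thesis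
      by simp
  qed
  have "ln (max 1 (poly_abs v F)) \<le> ln ((real d + 1) * (2 * real_of_int M) ^ d)
      + 1 / (real N - real d) * (\<Sum>i=1..N. ln (max 1 (v (poly F (of_int (x i))))))"
  proof (rule ln_max_le_average[OF assms(2) c])
    fix J T
    assume J: "J \<subseteq> {1..N}" "card J = d + 1" "\<And>j. j \<in> J \<Longrightarrow> v (poly F (of_int (x j))) \<le> T" "T \<ge> (0::real)"
    then show "poly_abs v F \<le> (real d + 1) * (2 * real_of_int M) ^ d * T"
      using assms False finite_subset[OF J(1)] inj_on_subset[OF assms(3) J(1)]
      by (intro arch_poly_abs_le[OF _ _ _ _ _ _ _ J(3,4)]) auto
  qed
  moreover have "ln ((real d + 1) * (2 * real_of_int M) ^ d) = real d * ln (2 * real_of_int M) + ln (real d + 1)"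
    using M(2) by (simp add: ln_mult ln_realpow distrib_left)
  ultimately show ?thesis
    using False by simp
qed

section \<open>Heights\<close>

definition weight :: "('a::field_char_0 \<Rightarrow> real) \<Rightarrow> real" where
  "weight v = real (local_degree v) / real (field_degree TYPE('a))"

lemma weight_nonneg [simp]: "0 \<le> weight v"
  by (simp add: weight_def)

lemma sum_weight_le_1:
  fixes S :: "('a::field_char_0 \<Rightarrow> real) set"
  assumes "number_field TYPE('a)" "finite S" "S \<subseteq> places" "same_on_rats S"
  shows "sum weight S \<le> 1"
proof -
  have "real (\<Sum>v\<in>S. local_degree v) \<le> real (field_degree TYPE('a))"
    using sum_local_degree_le[OF assms] by (simp only: of_nat_le_iff)
  then show ?thesis
    \<comment> \<open>Division by 0 gives 0, so a degree of 0 would make every weight 0.\<close>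
    by (cases "field_degree TYPE('a) = 0")
      (simp_all add: weight_def sum_divide_distrib[symmetric] divide_le_eq_1)
qed

lemma sum_weight_arch_le_1:
  fixes S :: "('a::field_char_0 \<Rightarrow> real) set"
  assumes "number_field TYPE('a)" "finite S" "S \<subseteq> places" "\<And>v. v \<in> S \<Longrightarrow> \<not> nonarchimedean v"
  shows "sum weight S \<le> 1"
proof (rule sum_weight_le_1[OF assms(1-3)])
  have "v (of_rat q) = \<bar>of_rat q\<bar>" if "v \<in> S" for v q
    using place.arch_of_rat[OF place_locale] assms(3,4) that by blast
  then show "same_on_rats S"
    unfolding same_on_rats_def by metis
qed

text \<open>The primes in \<open>P\<close> account for part of the factorisation of m, and that part
  divides m; primes of \<open>P\<close> not dividing m have exponent 0.\<close>

lemma sum_multiplicity_ln_le: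
  fixes m :: int
  assumes "finite P" "\<And>p. p \<in> P \<Longrightarrow> prime p" "m > 0"
  shows "(\<Sum>p\<in>P. real (multiplicity p m) * ln (real_of_int p)) \<le> ln (real_of_int m)"
proof -
  have pos: "p > 0" if "p \<in> P" for p
    using assms(2)[OF that] by (rule prime_gt_0_int)
  have "(\<Prod>p\<in>P. p ^ multiplicity p m) = (\<Prod>p\<in>P \<inter> prime_factors m. p ^ multiplicity p m)"
    using assms by (intro prod.mono_neutral_right)
      (auto simp: prime_factors_dvd not_dvd_imp_multiplicity_0)
  also have "\<dots> dvd (\<Prod>p\<in>prime_factors m. p ^ multiplicity p m)"
    by (intro prod_dvd_prod_subset) auto
  also have "\<dots> = m"
    using prime_factorization_int[OF assms(3)] by simp
  finally have "(\<Prod>p\<in>P. p ^ multiplicity p m) \<le> m"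
    using assms(3) by (rule zdvd_imp_le)
  then have "real_of_int (\<Prod>p\<in>P. p ^ multiplicity p m) \<le> real_of_int m"
    by (simp only: of_int_le_iff)
  moreover have "real_of_int (\<Prod>p\<in>P. p ^ multiplicity p m) > 0"
    using pos by (auto intro!: prod_pos)
  ultimately have "ln (real_of_int (\<Prod>p\<in>P. p ^ multiplicity p m)) \<le> ln (real_of_int m)"
    by simp
  also have "ln (real_of_int (\<Prod>p\<in>P. p ^ multiplicity p m)) =
      (\<Sum>p\<in>P. real (multiplicity p m) * ln (real_of_int p))"
    using pos assms(1) by (simp add: of_int_prod ln_prod ln_realpow)
  finally show ?thesis .
qed

text \<open>All places over p give 1 / n! the same absolute value, p raised to the multiplicity of p
  in n!, and their weights add up to at most 1. Grouping by p leaves at most the logarithm of the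
  prime factorisation of n!.\<close>

lemma sum_weight_ln_fact_le:
  fixes S :: "('a::field_char_0 \<Rightarrow> real) set"
  assumes nf: "number_field TYPE('a)" and fin: "finite S" and places: "S \<subseteq> places"
    and nonarch: "\<And>v. v \<in> S \<Longrightarrow> nonarchimedean v"
  shows "(\<Sum>v\<in>S. weight v * ln (v (1 / fact n))) \<le> ln (fact n)"
proof -
  have "\<exists>p. padic_abs_val v p" if "v \<in> S" for v
    using place.nonarch_padic[OF place_locale nonarch] places that by blast
  then obtain pr where pr: "\<And>v. v \<in> S \<Longrightarrow> padic_abs_val v (pr v)"
    by metis
  define c where "c p = real (multiplicity (int p) (fact n)) * ln (real p)" for p
  have prime: "prime (pr v)" if "v \<in> S" for v
    using padic_abs_val.prime_p[OF pr[OF that]] .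
  have c_nonneg: "c (pr v) \<ge> 0" if "v \<in> S" for v
    using prime_ge_1_nat[OF prime[OF that]] by (simp add: c_def)
  have ln_eq: "ln (v (1 / fact n)) = c (pr v)" if "v \<in> S" for v
  proof -
    interpret padic_abs_val v "pr v"
      using pr[OF that] .
    have "v (of_int (fact n)) = (1 / real (pr v)) ^ multiplicity (int (pr v)) (fact n)"
      by (rule of_int_eq) simp
    then have "v (1 / fact n) = real (pr v) ^ multiplicity (int (pr v)) (fact n)"
      by (simp add: divide power_one_over)
    then show ?thesis
      using prime_gt_0_nat[OF prime_p] by (simp add: c_def ln_realpow)
  qed
  have "(\<Sum>v\<in>S. weight v * ln (v (1 / fact n))) = (\<Sum>v\<in>S. weight v * c (pr v))"
    by (intro sum.cong) (auto simp: ln_eq)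
  also have "\<dots> = (\<Sum>p\<in>pr ` S. \<Sum>v\<in>{v \<in> S. pr v = p}. weight v * c (pr v))"
    by (rule sum.image_gen[OF fin])
  also have "\<dots> \<le> (\<Sum>p\<in>pr ` S. c p)"
  proof (rule sum_mono)
    fix p
    assume p: "p \<in> pr ` S"
    have "same_on_rats {v \<in> S. pr v = p}"
      unfolding same_on_rats_def
    proof (intro ballI allI)
      fix v w q
      assume "v \<in> {v \<in> S. pr v = p}" "w \<in> {v \<in> S. pr v = p}"
      then have "padic_abs_val v p" "padic_abs_val w p"
        using pr[of v] pr[of w] by auto
      then show "v (of_rat q) = w (of_rat q)"
        by (rule padic_of_rat_eq)
    qed
    then have "sum weight {v \<in> S. pr v = p} \<le> 1"
      using fin places by (intro sum_weight_le_1[OF nf]) auto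
    then have "sum weight {v \<in> S. pr v = p} * c p \<le> 1 * c p"
      using p c_nonneg by (intro mult_right_mono) auto
    then show "(\<Sum>v\<in>{v \<in> S. pr v = p}. weight v * c (pr v)) \<le> c p"
      by (simp add: sum_distrib_right)
  qed
  also have "\<dots> = (\<Sum>p\<in>int ` pr ` S. real (multiplicity p (fact n)) * ln (real_of_int p))"
    by (subst sum.reindex) (auto simp: c_def)
  also have "\<dots> \<le> ln (real_of_int (fact n))"
    using fin prime by (intro sum_multiplicity_ln_le) auto
  finally show ?thesis
    by simp
qed

section \<open>Convergence of the height series\<close>

lemma summable_weight_arch:
  fixes K :: real
  assumes nf: "number_field TYPE('a::field_char_0)" and "K \<ge> 0"
  shows "(\<lambda>v :: 'a \<Rightarrow> real. weight v * (if nonarchimedean v then 0 else K)) summable_on places"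
proof (rule nonneg_bdd_above_summable_on)
  show "bdd_above (sum (\<lambda>v :: 'a \<Rightarrow> real. weight v * (if nonarchimedean v then 0 else K)) `
      {F. F \<subseteq> places \<and> finite F})"
  proof (rule bdd_aboveI2)
    fix S :: "('a \<Rightarrow> real) set"
    assume S: "S \<in> {F. F \<subseteq> places \<and> finite F}"
    have "(\<Sum>v\<in>S. weight v * (if nonarchimedean v then 0 else K)) =
        (\<Sum>v\<in>{v \<in> S. \<not> nonarchimedean v}. weight v * K)"
      using S by (intro sum.mono_neutral_cong_right) auto
    also have "\<dots> = sum weight {v \<in> S. \<not> nonarchimedean v} * K"
      by (simp add: sum_distrib_right)
    also have "\<dots> \<le> 1 * K"
      using S assms(2) by (intro mult_right_mono sum_weight_arch_le_1[OF nf]) auto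
    finally show "(\<Sum>v\<in>S. weight v * (if nonarchimedean v then 0 else K)) \<le> K"
      by simp
  qed
qed (use assms in auto)

text \<open>This goes from coefficients to values, opposite to the interpolation bound, and serves
  convergence. Any C independent of v will do, provided that it is charged at archimedean places
  only.\<close>

lemma (in place) poly_value_le:
  fixes F :: "'a poly" and y :: int
  defines "C \<equiv> max 1 (\<Sum>k\<le>degree F. \<bar>real_of_int y\<bar> ^ k)"
  shows "ln (max 1 (v (poly F (of_int y)))) \<le>
    ln (max 1 (poly_abs v F)) + (if nonarchimedean v then 0 else ln C)"
proof (cases "nonarchimedean v")
  case True
  then interpret nonarch_abs_val v
    by unfold_locales
  have "v (poly F (of_int y)) \<le> max 1 (poly_abs v F)"
    unfolding poly_altdef
  proof (rule sum_le_bound)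
    fix k
    assume "k \<in> {..degree F}"
    then have "v (poly.coeff F k) \<le> poly_abs v F"
      by (simp add: poly_abs_coeff_le)
    moreover have "v (of_int y ^ k) \<le> 1"
      by (simp add: power power_le_one of_int_le_1)
    ultimately have "v (poly.coeff F k) * v (of_int y ^ k) \<le> max 1 (poly_abs v F) * 1"
      by (intro mult_mono) auto
    then show "v (poly.coeff F k * of_int y ^ k) \<le> max 1 (poly_abs v F)"
      by (simp only: mult mult_1_right)
  qed auto
  then show ?thesis
    using True by simp
next
  case False
  have "v (poly F (of_int y)) \<le> (\<Sum>k\<le>degree F. v (poly.coeff F k * of_int y ^ k))"
    unfolding poly_altdef by (rule sum_le)
  also have "\<dots> \<le> (\<Sum>k\<le>degree F. max 1 (poly_abs v F) * \<bar>real_of_int y\<bar> ^ k)"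
  proof (rule sum_mono)
    fix k
    assume "k \<in> {..degree F}"
    then have "v (poly.coeff F k) \<le> poly_abs v F"
      by (simp add: poly_abs_coeff_le)
    then have "v (poly.coeff F k) \<le> max 1 (poly_abs v F)"
      by simp
    then show "v (poly.coeff F k * of_int y ^ k) \<le> max 1 (poly_abs v F) * \<bar>real_of_int y\<bar> ^ k"
      unfolding mult power arch_of_int[OF False] by (intro mult_right_mono) auto
  qed
  also have "\<dots> = max 1 (poly_abs v F) * (\<Sum>k\<le>degree F. \<bar>real_of_int y\<bar> ^ k)"
    by (rule sum_distrib_left[symmetric])
  also have "\<dots> \<le> max 1 (poly_abs v F) * C"
    unfolding C_def by (intro mult_left_mono) auto
  finally have "v (poly F (of_int y)) \<le> max 1 (poly_abs v F) * C" .
  moreover have "1 * 1 \<le> max 1 (poly_abs v F) * C"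
    unfolding C_def by (intro mult_mono) auto
  ultimately have "ln (max 1 (v (poly F (of_int y)))) \<le> ln (max 1 (poly_abs v F) * C)"
    by (subst ln_le_cancel_iff) auto
  also have "\<dots> = ln (max 1 (poly_abs v F)) + ln C"
    by (subst ln_mult) (auto simp: C_def)
  finally show ?thesis
    using False by simp
qed

lemma height_nonneg: "0 \<le> height a"
  unfolding height_def by (intro infsum_nonneg) simp

text \<open>A partial sum is at most the height of the value only if the series for that height
  converges, since \<open>infsum\<close> is 0 otherwise. Comparison with the series for F supplies
  the convergence.\<close>

lemma summable_height_value:
  fixes F :: "'a::field_char_0 poly"
  assumes nf: "number_field TYPE('a)"
    and "(\<lambda>v. weight v * ln (max 1 (poly_abs v F))) summable_on places"
  shows "(\<lambda>v. weight v * ln (max 1 (v (poly F (of_int y))))) summable_on places"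
proof (rule summable_on_comparison_test)
  let ?K = "ln (max 1 (\<Sum>k\<le>degree F. \<bar>real_of_int y\<bar> ^ k))"
  show "(\<lambda>v. weight v * ln (max 1 (poly_abs v F)) + weight v * (if nonarchimedean v then 0 else ?K))
      summable_on places"
    by (intro summable_on_add assms summable_weight_arch) simp
  fix v :: "'a \<Rightarrow> real"
  assume "v \<in> places"
  from place.poly_value_le[OF place_locale[OF this], of F y]
  show "weight v * ln (max 1 (v (poly F (of_int y)))) \<le>
      weight v * ln (max 1 (poly_abs v F)) + weight v * (if nonarchimedean v then 0 else ?K)"
    by (simp only: distrib_left[symmetric] mult_left_mono weight_nonneg)
qed simp

lemma ln_fact_le: "ln (fact n :: real) \<le> real n * ln (real n)"
proof (cases "n = 0")
  case False
  have "(fact n :: real) \<le> real n ^ n"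
    using fact_le_power[of n, where 'a = real] by simp
  then have "ln (fact n :: real) \<le> ln (real n ^ n)"
    using False by (subst ln_le_cancel_iff) auto
  then show ?thesis
    using False by (simp add: ln_realpow)
qed simp

lemma sum_weight_constants_le:
  fixes S :: "('a::field_char_0 \<Rightarrow> real) set"
  assumes nf: "number_field TYPE('a)" and "finite S" "S \<subseteq> places" and "K \<ge> 0"
  shows "(\<Sum>v\<in>S. weight v * (if nonarchimedean v then ln (v (1 / fact n)) else K)) \<le> ln (fact n) + K"
proof -
  let ?N = "{v \<in> S. nonarchimedean v}" and ?A = "{v \<in> S. \<not> nonarchimedean v}"
  let ?f = "\<lambda>v. weight v * (if nonarchimedean v then ln (v (1 / fact n)) else K)"
  have "sum ?f S = sum ?f ?N + sum ?f ?A"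
    using assms(2) by (subst sum.union_disjoint[symmetric]) (auto intro: sum.cong)
  also have "sum ?f ?N = (\<Sum>v\<in>?N. weight v * ln (v (1 / fact n)))"
    by (intro sum.cong) auto
  also have "\<dots> \<le> ln (fact n)"
    using assms by (intro sum_weight_ln_fact_le[OF nf]) auto
  also have "sum ?f ?A = sum weight ?A * K"
    by (simp add: sum_distrib_right)
  also have "\<dots> \<le> 1 * K"
    using assms by (intro mult_right_mono sum_weight_arch_le_1[OF nf]) auto
  finally show ?thesis
    by simp
qed

theorem theorem3p4:
  fixes F :: "'a::field_char_0 poly"
    and A B D M :: int
    and d N :: nat
    and H :: real
    and x :: "nat \<Rightarrow> int"
  assumes "number_field TYPE('a)"
    and "A \<le> B"
    and "D = B - A"
    and "M = max \<bar>A\<bar> \<bar>B\<bar>"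
    and "d \<ge> 1"
    and "degree F \<le> d"
    and "N \<ge> d + 1"
    and "inj_on x {1..N}"
    and "\<forall>i\<in>{1..N}. x i \<in> {A..B}"
    and "\<forall>i\<in>{1..N}. height (poly F (of_int (x i))) \<le> H"
  shows "poly_height F \<le> real N / (real N - real d) * H + real_of_int D * ln (real_of_int D)
           + real d * ln (2 * real_of_int M) + ln (real d + 1)
       \<and> (\<forall>v\<in>places.
            ln (max 1 (poly_abs v F))
            \<le> (if nonarchimedean v then ln (v (1 / fact (nat D)))
                else real d * ln (2 * real_of_int M) + ln (real d + 1))
              + 1 / (real N - real d) * (\<Sum>i=1..N. ln (max 1 (v (poly F (of_int (x i)))))))"
proof
  note nf = assms(1)
  define K where "K = real d * ln (2 * real_of_int M) + ln (real d + 1)"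
  \<comment> \<open>N \<ge> 2 distinct integers lie in an interval with D + 1 elements, which forces
    D \<ge> 1; then A and B are not both 0, so M \<ge> 1.\<close>
  have "N = card (x ` {1..N})"
    using card_image[OF assms(8)] by simp
  also have "\<dots> \<le> card {A..B}"
    using assms(9) by (intro card_mono) auto
  finally have "N \<le> nat (D + 1)"
    using assms(3) by simp
  then have D1: "D \<ge> 1"
    using assms(5,7) by linarith
  have M1: "M \<ge> 1"
    using D1 assms(3,4) by linarith
  have xM: "\<bar>x i\<bar> \<le> M" if "i \<in> {1..N}" for i
    using assms(4,9) that by fastforce
  have K0: "K \<ge> 0"
    using M1 by (simp add: K_def)
  have Nd: "real N - real d > 0"
    using assms(7) by simp
  show local_bound: "\<forall>v\<in>places.
            ln (max 1 (poly_abs v F))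
            \<le> (if nonarchimedean v then ln (v (1 / fact (nat D)))
                else real d * ln (2 * real_of_int M) + ln (real d + 1))
              + 1 / (real N - real d) * (\<Sum>i=1..N. ln (max 1 (v (poly F (of_int (x i))))))"
    unfolding assms(3)
    using assms xM M1 by (intro ballI place.local_height_bound[OF place_locale]) auto
  \<comment> \<open>There is at least one point, and heights are nonnegative. That H \<ge> 0 is what
    settles the case of a divergent series.\<close>
  have "0 \<le> height (poly F (of_int (x 1)))"
    by (rule height_nonneg)
  also have "\<dots> \<le> H"
    using assms(7,10) by auto
  finally have H0: "H \<ge> 0" .
  \<comment> \<open>Summing the local constants gives ln D!, which is weakened to D ln D at the end
    through D! \<le> D^D.\<close>
  have "poly_height F \<le> ln (fact (nat D)) + K + real N / (real N - real d) * H"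
  proof (cases "(\<lambda>v. weight v * ln (max 1 (poly_abs v F))) summable_on places")
    case False
    then have "poly_height F = 0"
      unfolding poly_height_def weight_def by (rule infsum_not_exists)
    moreover have "ln (fact (nat D)) \<ge> (0 :: real)"
      by (simp add: fact_ge_1)
    ultimately show ?thesis
      using K0 H0 Nd by simp
  next
    case True
    let ?C = "\<lambda>v. if nonarchimedean v then ln (v (1 / fact (nat D))) else K"
    let ?g = "\<lambda>i v. weight v * ln (max 1 (v (poly F (of_int (x i)))))"
    show ?thesis
      unfolding poly_height_def weight_def[symmetric]
    \<comment> \<open>Working with finite sets of places keeps the exchange of the sums over places
      and points elementary.\<close>
    proof (rule infsum_le_finite_sums[OF True])
      fix S :: "('a \<Rightarrow> real) set"
      assume S: "finite S" "S \<subseteq> places"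
      have "(\<Sum>v\<in>S. weight v * ln (max 1 (poly_abs v F))) \<le>
          (\<Sum>v\<in>S. weight v * (?C v + 1 / (real N - real d) * (\<Sum>i=1..N. ln (max 1 (v (poly F (of_int (x i))))))))"
        unfolding K_def
        by (intro sum_mono mult_left_mono bspec[OF local_bound] subsetD[OF S(2)] weight_nonneg)
      also have "\<dots> = (\<Sum>v\<in>S. weight v * ?C v) + 1 / (real N - real d) * (\<Sum>v\<in>S. \<Sum>i=1..N. ?g i v)"
        by (simp add: distrib_left sum.distrib sum_distrib_left mult.left_commute)
      also have "(\<Sum>v\<in>S. \<Sum>i=1..N. ?g i v) = (\<Sum>i=1..N. \<Sum>v\<in>S. ?g i v)"
        by (rule sum.swap)
      also have "\<dots> \<le> (\<Sum>i=1..N. H)"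
      proof (rule sum_mono)
        fix i
        assume i: "i \<in> {1..N}"
        have "(\<Sum>v\<in>S. ?g i v) \<le> (\<Sum>\<^sub>\<infinity>v\<in>places. ?g i v)"
          using S by (intro finite_sum_le_infsum summable_height_value[OF nf True]) auto
        also have "\<dots> = height (poly F (of_int (x i)))"
          by (simp add: height_def weight_def)
        also have "\<dots> \<le> H"
          using assms(10) i by blast
        finally show "(\<Sum>v\<in>S. ?g i v) \<le> H" .
      qed
      also have "(\<Sum>v\<in>S. weight v * ?C v) \<le> ln (fact (nat D)) + K"
        using S K0 by (intro sum_weight_constants_le[OF nf])
      finally show "(\<Sum>v\<in>S. weight v * ln (max 1 (poly_abs v F))) \<le>
          ln (fact (nat D)) + K + real N / (real N - real d) * H"
        using Nd by (simp add: divide_right_mono)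
    qed
  qed
  moreover have "ln (fact (nat D) :: real) \<le> real_of_int D * ln (real_of_int D)"
    using ln_fact_le[of "nat D"] D1 by simp
  ultimately show "poly_height F \<le> real N / (real N - real d) * H + real_of_int D * ln (real_of_int D)
           + real d * ln (2 * real_of_int M) + ln (real d + 1)"
    unfolding K_def by linarith
qed

end
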